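(* Let $\{b^n:n\ge1\}$ be a sequence of measurable vector fields $b^n:[0,T]\times\mathbb{R}^d\to\mathbb{R}^d$ equi-bounded in $L^\infty([0,T]\times\mathbb{R}^d)$. For every $n\ge1$, assume that $b^n$ satisfies condition (H) (with the same fixed function $\rho$) with the function $g^n$, and that the family $\{g^n:n\ge1\}$ is equi-bounded in $L^1([0,T],L^1_{loc}(\mathbb{R}^d))$. Let $X^n$ be a regular Lagrangian flow associated to $b^n$ with the compressibility constant $L_n$. Suppose $\sup_{n\ge1}L_n\le L<\infty$. Then the sequence $\{X^n:n\ge1\}$ is strongly precompact in $L^1_{loc}([0,T]\times\mathbb{R}^d)$.
   Context: Notation: $T>0$; $\mathcal{L}^d$ is Lebesgue measure on $\mathbb{R}^d$; $B(R)$ is the ball in $\mathbb{R}^d$ centered at $0$ with radius $R$. Equi-boundedness of $\{g^n\}$ in $L^1([0,T],L^1_{loc}(\mathbb{R}^d))$ means $\sup_{n\ge1}\|g^n\|_{L^1([0,T]\times B(R))}<\infty$ for every $R>0$. Fix a function $\rho\in C(\mathbb{R}_+,\mathbb{R}_+)$ which is strictly increasing, with $\rho(0)=0$ and $\int_{0+}\frac{\mathrm{d} s}{\rho(s)}=\infty$. Condition (H): a measurable vector field $b:[0,T]\times\mathbb{R}^d\to\mathbb{R}^d$ satisfies (H) with the function $g$ if $g\in L^1([0,T],L^1_{loc}(\mathbb{R}^d))$ is nonnegative and there are Lebesgue negligible subsets $N_t\subset\mathbb{R}^d$ such that for all $t\in[0,T]$ and all $x,y\notin N_t$, $|b_t(x)-b_t(y)|\le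 (g_t(x)+g_t(y))\,\rho(|x-y|)$. Regular Lagrangian flow: a map $X:[0,T]\times\mathbb{R}^d\to\mathbb{R}^d$ is a regular Lagrangian flow associated to $b\in L^1_{loc}([0,T]\times\mathbb{R}^d,\mathbb{R}^d)$ if (i) for a.e. $x\in\mathbb{R}^d$, the function $t\mapsto X_t(x)$ is absolutely continuous and satisfies $X_t(x)=x+\int_0^t b_s(X_s(x))\,\mathrm{d} s$ for all $t\in[0,T]$; (ii) there is a constant $L>0$ independent of $t\in[0,T]$ such that $(X_t)_\#\mathcal{L}^d\le L\mathcal{L}^d$ for all $t\in[0,T]$, where $(X_t)_\#\mathcal{L}^d$ is the push-forward measure. Such $L$ is called the compressibility constant of $X$. *)

theory Defs
  imports "HOL-Analysis.Analysis" "HOL-Probability.Essential_Supremum"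
begin

text \<open>
  The space \<open>\<real>\<^sup>d\<close> is a type \<open>'a\<close> of class \<^class>\<open>euclidean_space\<close>. Functions on \<open>[0,T] \<times> \<real>\<^sup>d\<close> are
  curried; only their values at times in \<open>{0..T}\<close> matter. "Measurable" on \<open>[0,T] \<times> \<real>\<^sup>d\<close> means
  Lebesgue measurable in the pair \<open>(t, x)\<close>.
\<close>

definition space_time_measure :: "real \<Rightarrow> (real \<times> 'a::euclidean_space) measure" where
  "space_time_measure T = lebesgue_on ({0..T} \<times> UNIV)"

definition Linf_norm ::
    "real \<Rightarrow> (real \<Rightarrow> 'a::euclidean_space \<Rightarrow> 'b::real_normed_vector) \<Rightarrow> ennreal" where
  "Linf_norm T f = esssup (space_time_measure T) (\<lambda>(t, x). ennreal (norm (f t x)))"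

definition L1_norm ::
    "real \<Rightarrow> real \<Rightarrow> (real \<Rightarrow> 'a::euclidean_space \<Rightarrow> 'b::real_normed_vector) \<Rightarrow> ennreal" where
  "L1_norm T R f = (\<integral>\<^sup>+p\<in>{0..T} \<times> ball 0 R. (case p of (t, x) \<Rightarrow> ennreal (norm (f t x))) \<partial>lebesgue)"

text \<open>
  As \<open>[0,T]\<close> is compact, membership in \<open>L\<^sup>1\<^sub>l\<^sub>o\<^sub>c([0,T] \<times> \<real>\<^sup>d)\<close> and in \<open>L\<^sup>1([0,T], L\<^sup>1\<^sub>l\<^sub>o\<^sub>c(\<real>\<^sup>d))\<close> both mean
  integrability on \<open>[0,T] \<times> B(R)\<close> for every \<open>R > 0\<close>.
\<close>

definition L1_loc ::
    "real \<Rightarrow> (real \<Rightarrow> 'a::euclidean_space \<Rightarrow> 'b::{banach, second_countable_topology}) set" where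
  "L1_loc T = {f. \<forall>R>0. set_integrable lebesgue ({0..T} \<times> ball 0 R) (\<lambda>(t, x). f t x)}"

text \<open>
  Relative compactness in the (complete, metrizable) space \<open>L\<^sup>1\<^sub>l\<^sub>o\<^sub>c([0,T] \<times> \<real>\<^sup>d)\<close> with its strong
  topology, i.e. that of the seminorms \<open>L1_norm T R\<close> for \<open>R > 0\<close>, expressed by sequences.
\<close>

definition precompact_L1_loc ::
    "real \<Rightarrow> (real \<Rightarrow> 'a::euclidean_space \<Rightarrow> 'b::{banach, second_countable_topology}) set \<Rightarrow> bool" where
  "precompact_L1_loc T F \<longleftrightarrow>
     F \<subseteq> L1_loc T \<and>
     (\<forall>u :: nat \<Rightarrow> real \<Rightarrow> 'a \<Rightarrow> 'b. range u \<subseteq> F \<longrightarrow>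
        (\<exists>r v. strict_mono r \<and> v \<in> L1_loc T \<and>
           (\<forall>R>0. (\<lambda>k. L1_norm T R (\<lambda>t x. u (r k) t x - v t x)) \<longlonglongrightarrow> 0)))"

text \<open>The last conjunct is \<open>\<integral>\<^sub>0\<^sub>+ ds / \<rho>(s) = \<infinity>\<close>: divergence at \<open>0\<close>, on every right neighbourhood.\<close>

definition osgood_modulus :: "(real \<Rightarrow> real) \<Rightarrow> bool" where
  "osgood_modulus \<rho> \<longleftrightarrow>
     continuous_on {0..} \<rho> \<and> \<rho> \<in> {0..} \<rightarrow> {0..} \<and> strict_mono_on {0..} \<rho> \<and> \<rho> 0 = 0 \<and>
     (\<forall>\<delta>>0. (\<integral>\<^sup>+s\<in>{0<..\<delta>}. ennreal (1 / \<rho> s) \<partial>lborel) = \<infinity>)"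

definition condition_H ::
    "real \<Rightarrow> (real \<Rightarrow> real) \<Rightarrow> (real \<Rightarrow> 'a::euclidean_space \<Rightarrow> 'a) \<Rightarrow> (real \<Rightarrow> 'a \<Rightarrow> real) \<Rightarrow> bool" where
  "condition_H T \<rho> b g \<longleftrightarrow>
     (\<lambda>(t, x). b t x) \<in> borel_measurable (space_time_measure T) \<and>
     g \<in> L1_loc T \<and> (\<forall>t\<in>{0..T}. \<forall>x. 0 \<le> g t x) \<and>
     (\<exists>N. \<forall>t\<in>{0..T}. negligible (N t) \<and>
        (\<forall>x y. x \<notin> N t \<longrightarrow> y \<notin> N t \<longrightarrow>
           norm (b t x - b t y) \<le> (g t x + g t y) * \<rho> (norm (x - y))))"

text \<open>
  Absolute continuity of a curve on \<open>{c..d}\<close> (the library's \<^const>\<open>absolutely_continuous\<close> is the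
  notion for measures).
\<close>

definition abs_continuous_curve :: "real \<Rightarrow> real \<Rightarrow> (real \<Rightarrow> 'a::real_normed_vector) \<Rightarrow> bool" where
  "abs_continuous_curve c d f \<longleftrightarrow>
     (\<forall>\<epsilon>>0. \<exists>\<delta>>0. \<forall>(n::nat) \<alpha> \<beta>.
        (\<forall>i<n. c \<le> \<alpha> i \<and> \<alpha> i \<le> \<beta> i \<and> \<beta> i \<le> d) \<longrightarrow>
        (\<forall>i<n. \<forall>j<n. i \<noteq> j \<longrightarrow> {\<alpha> i<..<\<beta> i} \<inter> {\<alpha> j<..<\<beta> j} = {}) \<longrightarrow>
        (\<Sum>i<n. \<beta> i - \<alpha> i) < \<delta> \<longrightarrow>
        (\<Sum>i<n. norm (f (\<beta> i) - f (\<alpha> i))) < \<epsilon>)"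

text \<open>
  Each \<open>X t\<close> is required to be Lebesgue measurable, which the push-forward presupposes. Since the
  two measures compared have the same sets, \<open>\<le>\<close> is the inequality on every Borel set.
\<close>

definition compressibility_constant ::
    "real \<Rightarrow> (real \<Rightarrow> 'a::euclidean_space \<Rightarrow> 'a) \<Rightarrow> real \<Rightarrow> bool" where
  "compressibility_constant T X L \<longleftrightarrow>
     0 < L \<and>
     (\<forall>t\<in>{0..T}. X t \<in> borel_measurable lebesgue \<and>
        distr lebesgue lborel (X t) \<le> scale_measure (ennreal L) lborel)"

text \<open>
  Integrability of \<open>s \<mapsto> b s (X s x)\<close> is stated explicitly because the Bochner integral of a
  non-integrable function is \<open>0\<close> by convention.
\<close>

definition regular_lagrangian_flow ::
    "real \<Rightarrow> (real \<Rightarrow> 'a::euclidean_space \<Rightarrow> 'a) \<Rightarrow> (real \<Rightarrow> 'a \<Rightarrow> 'a) \<Rightarrow> bool" where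
  "regular_lagrangian_flow T b X \<longleftrightarrow>
     b \<in> L1_loc T \<and>
     (AE x in lebesgue.
        abs_continuous_curve 0 T (\<lambda>t. X t x) \<and>
        set_integrable lebesgue {0..T} (\<lambda>s. b s (X s x)) \<and>
        (\<forall>t\<in>{0..T}. X t x = x + (LINT s:{0..t}|lebesgue. b s (X s x)))) \<and>
     (\<exists>L. compressibility_constant T X L)"

end

theory Submission
  imports Defs "HOL-Complex_Analysis.Great_Picard" "HOL-Library.Diagonal_Subsequence"
begin

text \<open>
  The argument combines an Osgood estimate, uniform in \<open>n\<close>, for the distance of two trajectories
  with a mollification argument.

  Put \<open>\<psi>\<^sub>\<delta>(s) = \<integral>\<^sub>0\<^sup>s dr / (\<delta> + \<rho>(r))\<close>. For almost every pair \<open>(x, y)\<close> condition (H) gives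
  \<open>\<psi>\<^sub>\<delta>(|X\<^sub>t(x) - X\<^sub>t(y)|) \<le> \<psi>\<^sub>\<delta>(|x - y|) + G(x) + G(y)\<close> with \<open>G(x) = \<integral>\<^sub>0\<^sup>T g\<^sub>s(X\<^sub>s(x)) ds\<close>. The velocity is
  at most \<open>M\<close>, so trajectories starting in \<open>B(R)\<close> stay in \<open>B(R + MT)\<close>, and compressibility bounds
  the integral of \<open>G\<close> over \<open>B(R)\<close> by \<open>L\<close> times the \<open>L\<^sup>1\<close> norm of \<open>g\<close> on \<open>[0,T] \<times> B(R + MT)\<close>, hence uniformly in
  \<open>n\<close>. This is \<open>flow_osgood_estimate\<close>.

  For \<open>|x - y| < r\<close> take \<open>\<delta> = r\<close>: then \<open>\<psi>\<^sub>r(|x - y|) \<le> 1\<close>, and wherever \<open>|X\<^sub>t(x) - X\<^sub>t(y)| > \<eta>\<close> one has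
  \<open>1 \<le> (1 + G(x) + G(y)) / \<psi>\<^sub>r(\<eta>)\<close>. As the distance never exceeds \<open>r + 2MT\<close>, averaging over \<open>y\<close> with a
  kernel of radius \<open>r\<close> and integrating over \<open>x \<in> B(R)\<close> bounds the \<open>L\<^sup>1\<close> distance between a flow and its
  mollification by \<open>\<eta> |B(R)|\<close> plus a constant divided by \<open>\<psi>\<^sub>r(\<eta>)\<close> (\<open>mollify_error\<close>). The Osgood condition says
  exactly that \<open>\<psi>\<^sub>r(\<eta>) \<rightarrow> \<infinity>\<close> as \<open>r \<rightarrow> 0\<close> (\<open>osgood_primitive_at_top\<close>), so the flows are approximated by
  their mollifications uniformly in \<open>n\<close>.

  For fixed \<open>r\<close> the mollified flows are bounded and equi-Lipschitz, locally in \<open>(t, x)\<close>, so one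
  subsequence makes them converge pointwise for all radii \<open>1, 1/2, 1/3, \<dots>\<close> (\<open>mollified_subsequence\<close>). That
  subsequence of the flows is Cauchy in \<open>L\<^sup>1([0,T] \<times> B(R))\<close> for every \<open>R\<close>; a further diagonal subsequence
  converges almost everywhere (\<open>subsequence_AE_convergent\<close>), and dominated convergence concludes.
\<close>

section \<open>The Osgood modulus and its primitives\<close>

text \<open>The primitive of \<open>1 / (\<delta> + \<rho>)\<close> vanishing at \<open>0\<close>; it is meant for \<open>\<delta> > 0\<close> and \<open>s \<ge> 0\<close>.\<close>

definition osgood_primitive :: "(real \<Rightarrow> real) \<Rightarrow> real \<Rightarrow> real \<Rightarrow> real" where
  "osgood_primitive \<rho> \<delta> s = integral {0..s} (\<lambda>r. 1 / (\<delta> + \<rho> r))"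

lemma osgood_modulus_nonneg: "osgood_modulus \<rho> \<Longrightarrow> 0 \<le> s \<Longrightarrow> 0 \<le> \<rho> s"
  by (auto simp: osgood_modulus_def)

lemma osgood_modulus_mono: "osgood_modulus \<rho> \<Longrightarrow> 0 \<le> s \<Longrightarrow> s \<le> t \<Longrightarrow> \<rho> s \<le> \<rho> t"
  unfolding osgood_modulus_def by (elim conjE, rule strict_mono_on_leD[of "{0..}" \<rho>]) auto

lemma osgood_modulus_continuous: "osgood_modulus \<rho> \<Longrightarrow> continuous_on {0..} \<rho>"
  by (auto simp: osgood_modulus_def)

context
  fixes \<rho> :: "real \<Rightarrow> real" and \<delta> :: real
  assumes \<rho>: "osgood_modulus \<rho>" and \<delta>: "0 < \<delta>"
begin

lemma osgood_integrand_continuous: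
  "0 \<le> a \<Longrightarrow> continuous_on {a..b} (\<lambda>r. 1 / (\<delta> + \<rho> r))"
  using osgood_modulus_nonneg[OF \<rho>] \<delta>
  by (intro continuous_intros continuous_on_subset[OF osgood_modulus_continuous[OF \<rho>]])
     (auto simp: add_nonneg_eq_0_iff)

lemma osgood_integrand_integrable: "0 \<le> a \<Longrightarrow> (\<lambda>r. 1 / (\<delta> + \<rho> r)) integrable_on {a..b}"
  by (intro integrable_continuous_real osgood_integrand_continuous)

lemma osgood_primitive_diff:
  assumes "0 \<le> a" "a \<le> b"
  shows "osgood_primitive \<rho> \<delta> b - osgood_primitive \<rho> \<delta> a = integral {a..b} (\<lambda>r. 1 / (\<delta> + \<rho> r))"
  unfolding osgood_primitive_def
  using Henstock_Kurzweil_Integration.integral_combine[OF assms osgood_integrand_integrable[of 0 b]] by simp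

lemma osgood_primitive_0 [simp]: "osgood_primitive \<rho> \<delta> 0 = 0"
  by (simp add: osgood_primitive_def)

lemma osgood_primitive_mono:
  assumes "0 \<le> a" "a \<le> b"
  shows "osgood_primitive \<rho> \<delta> a \<le> osgood_primitive \<rho> \<delta> b"
proof -
  have "0 \<le> integral {a..b} (\<lambda>r. 1 / (\<delta> + \<rho> r))"
    using osgood_modulus_nonneg[OF \<rho>] \<delta> assms
    by (intro integral_nonneg osgood_integrand_integrable) (auto intro!: divide_nonneg_nonneg add_nonneg_nonneg)
  then show ?thesis using osgood_primitive_diff[OF assms] by simp
qed

lemma osgood_primitive_nonneg: "0 \<le> s \<Longrightarrow> 0 \<le> osgood_primitive \<rho> \<delta> s"
  using osgood_primitive_mono[of 0 s] by simp

text \<open>Concavity: the increment is at most the left slope times the length.\<close>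

lemma osgood_primitive_increment_le:
  assumes "0 \<le> a" "a \<le> b"
  shows "osgood_primitive \<rho> \<delta> b - osgood_primitive \<rho> \<delta> a \<le> (b - a) / (\<delta> + \<rho> a)"
proof -
  have "integral {a..b} (\<lambda>r. 1 / (\<delta> + \<rho> r)) \<le> integral {a..b} (\<lambda>r. 1 / (\<delta> + \<rho> a))"
    using osgood_modulus_nonneg[OF \<rho>] \<delta> assms osgood_modulus_mono[OF \<rho>]
    by (intro integral_le osgood_integrand_integrable) (auto intro!: divide_left_mono mult_pos_pos add_pos_nonneg)
  then show ?thesis using osgood_primitive_diff[OF assms] assms by simp
qed

lemma osgood_primitive_le: "0 \<le> s \<Longrightarrow> osgood_primitive \<rho> \<delta> s \<le> s / \<delta>"
  using osgood_primitive_increment_le[of 0 s] \<rho> by (simp add: osgood_modulus_def)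

lemma nn_integral_osgood_primitive:
  assumes "0 \<le> s"
  shows "(\<integral>\<^sup>+r\<in>{0..s}. ennreal (1 / (\<delta> + \<rho> r)) \<partial>lborel) = ennreal (osgood_primitive \<rho> \<delta> s)"
proof -
  have "((\<lambda>r. 1 / (\<delta> + \<rho> r)) has_integral osgood_primitive \<rho> \<delta> s) {0..s}"
    unfolding osgood_primitive_def using osgood_integrand_integrable[of 0 s] by (simp add: integrable_integral)
  then show ?thesis
    using osgood_modulus_nonneg[OF \<rho>] \<delta>
    by (intro nn_integral_has_integral_lebesgue')
      (auto intro!: divide_nonneg_nonneg add_nonneg_nonneg)
qed

text \<open>
  The comparison principle behind the Osgood condition. Discretizing time, no differentiation
  is needed: on a short interval \<open>\<rho> \<circ> h\<close> exceeds its initial value by at most \<open>\<delta>\<close>.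
\<close>

lemma osgood_comparison:
  fixes h \<Gamma> :: "real \<Rightarrow> real"
  assumes cont: "continuous_on {0..T} h" and nonneg: "\<And>t. 0 \<le> t \<Longrightarrow> t \<le> T \<Longrightarrow> 0 \<le> h t"
    and incr: "\<And>s t c. 0 \<le> s \<Longrightarrow> s \<le> t \<Longrightarrow> t \<le> T \<Longrightarrow> (\<And>u. s \<le> u \<Longrightarrow> u \<le> t \<Longrightarrow> \<rho> (h u) \<le> c)
                 \<Longrightarrow> h t - h s \<le> c * (\<Gamma> t - \<Gamma> s)"
    and mono: "\<And>s t. 0 \<le> s \<Longrightarrow> s \<le> t \<Longrightarrow> t \<le> T \<Longrightarrow> \<Gamma> s \<le> \<Gamma> t"
    and t: "0 \<le> t" "t \<le> T"
  shows "osgood_primitive \<rho> \<delta> (h t) \<le> osgood_primitive \<rho> \<delta> (h 0) + (\<Gamma> t - \<Gamma> 0)"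
proof -
  have "continuous_on {0..T} (\<lambda>u. \<rho> (h u))"
    by (rule continuous_on_compose2[OF osgood_modulus_continuous[OF \<rho>] cont]) (auto intro: nonneg)
  then have "uniformly_continuous_on {0..T} (\<lambda>u. \<rho> (h u))"
    by (intro compact_uniformly_continuous) auto
  then obtain \<kappa> where \<kappa>: "\<kappa> > 0"
    and uc: "\<And>s u. 0 \<le> s \<Longrightarrow> s \<le> T \<Longrightarrow> 0 \<le> u \<Longrightarrow> u \<le> T \<Longrightarrow> \<bar>u - s\<bar> < \<kappa> \<Longrightarrow> \<bar>\<rho> (h u) - \<rho> (h s)\<bar> < \<delta>"
    unfolding uniformly_continuous_on_def dist_real_def using \<delta> by (metis atLeastAtMost_iff)
  define D where "D = (\<lambda>t. osgood_primitive \<rho> \<delta> (h t) - \<Gamma> t)"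
  have step: "D t \<le> D s" if st: "0 \<le> s" "s \<le> t" "t \<le> T" "t - s < \<kappa>" for s t
  proof (cases "h t \<le> h s")
    case True
    then have "osgood_primitive \<rho> \<delta> (h t) \<le> osgood_primitive \<rho> \<delta> (h s)"
      using nonneg st by (intro osgood_primitive_mono) auto
    with mono[OF st(1-3)] show ?thesis by (simp add: D_def)
  next
    case False
    have hs: "0 \<le> h s" using nonneg st by simp
    have pos: "0 < \<delta> + \<rho> (h s)" using osgood_modulus_nonneg[OF \<rho> hs] \<delta> by simp
    have "\<rho> (h u) \<le> \<delta> + \<rho> (h s)" if "s \<le> u" "u \<le> t" for u
      using uc[of s u] that st by (simp add: abs_less_iff)
    from incr[OF st(1-3) this] have "h t - h s \<le> (\<delta> + \<rho> (h s)) * (\<Gamma> t - \<Gamma> s)" .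
    then have "(h t - h s) / (\<delta> + \<rho> (h s)) \<le> \<Gamma> t - \<Gamma> s"
      using pos by (simp add: divide_le_eq mult.commute)
    with osgood_primitive_increment_le[of "h s" "h t"] hs False show ?thesis by (simp add: D_def)
  qed
  \<comment> \<open>Reach \<open>t\<close> in steps of length \<open>\<kappa>/2\<close>, which is less than \<open>\<kappa>\<close>.\<close>
  have "t \<le> T \<Longrightarrow> 0 \<le> t \<Longrightarrow> t \<le> real n * (\<kappa>/2) \<Longrightarrow> D t \<le> D 0" for n t
  proof (induction n arbitrary: t)
    case (Suc n)
    define s where "s = max 0 (t - \<kappa>/2)"
    have "D t \<le> D s" using Suc.prems \<kappa> by (intro step) (auto simp: s_def max_def)
    also have "D s \<le> D 0" using Suc.prems \<kappa> by (intro Suc.IH) (auto simp: s_def max_def algebra_simps)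
    finally show ?case .
  qed auto
  moreover obtain n where "t / (\<kappa>/2) \<le> real n" using real_arch_simple by blast
  ultimately have "D t \<le> D 0" using t \<kappa> by (simp add: field_simps)
  then show ?thesis by (simp add: D_def)
qed

end

text \<open>What the Osgood condition provides: for a fixed \<open>s > 0\<close> the primitives blow up as \<open>\<delta> \<rightarrow> 0\<close>.\<close>

lemma osgood_primitive_at_top:
  assumes \<rho>: "osgood_modulus \<rho>" and s: "0 < s"
  shows "\<exists>m. B \<le> osgood_primitive \<rho> (1 / real (Suc m)) s"
proof (rule ccontr)
  assume "\<not> ?thesis"
  then have B: "osgood_primitive \<rho> (1 / real (Suc m)) s < B" for m by (simp add: not_le)
  \<comment> \<open>Nothing is known about \<open>\<rho>\<close> on negative numbers, so it is extended to a continuous function.\<close>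
  define \<rho>' where "\<rho>' = (\<lambda>r. \<rho> (max 0 r))"
  have "continuous_on UNIV \<rho>'"
    unfolding \<rho>'_def
    by (rule continuous_on_compose2[OF osgood_modulus_continuous[OF \<rho>]]) (auto intro!: continuous_intros)
  then have [measurable]: "\<rho>' \<in> borel_measurable borel" by (rule borel_measurable_continuous_onI)
  have nn: "0 \<le> \<rho>' r" for r unfolding \<rho>'_def by (intro osgood_modulus_nonneg[OF \<rho>]) simp
  define f where "f = (\<lambda>m r. ennreal (1 / (1 / real (Suc m) + \<rho>' r)) * indicator {0..s} r)"
  have [measurable]: "f m \<in> borel_measurable lborel" for m unfolding f_def by measurable
  have int_f: "(\<integral>\<^sup>+r. f m r \<partial>lborel) \<le> ennreal B" for m
  proof -
    have "(\<integral>\<^sup>+r. f m r \<partial>lborel) = (\<integral>\<^sup>+r\<in>{0..s}. ennreal (1 / (1 / real (Suc m) + \<rho> r)) \<partial>lborel)"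
      unfolding f_def \<rho>'_def by (intro nn_integral_cong) (auto simp: indicator_def max_def)
    also have "\<dots> = ennreal (osgood_primitive \<rho> (1 / real (Suc m)) s)"
      using s by (intro nn_integral_osgood_primitive[OF \<rho>]) auto
    finally show ?thesis using B[of m] by (simp add: ennreal_leI)
  qed
  have inc: "incseq f"
  proof (rule incseq_SucI, rule le_funI)
    fix m r
    have "1 / real (Suc (Suc m)) \<le> 1 / real (Suc m)" by (simp add: field_simps)
    then have "1 / (1 / real (Suc m) + \<rho>' r) \<le> 1 / (1 / real (Suc (Suc m)) + \<rho>' r)"
      using nn[of r] by (intro divide_left_mono mult_pos_pos add_pos_nonneg) auto
    then show "f m r \<le> f (Suc m) r"
      unfolding f_def by (intro mult_right_mono ennreal_leI) auto
  qed
  have "\<infinity> = (\<integral>\<^sup>+r\<in>{0<..s}. ennreal (1 / \<rho> r) \<partial>lborel)"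
    using \<rho> s by (simp add: osgood_modulus_def)
  also have "\<dots> \<le> (\<integral>\<^sup>+r. (SUP m. f m r) \<partial>lborel)"
  proof (intro nn_integral_mono)
    fix r
    show "ennreal (1 / \<rho> r) * indicator {0<..s} r \<le> (SUP m. f m r)"
    proof (cases "r \<in> {0<..s}")
      case True
      then have "\<rho> 0 < \<rho> r"
        using \<rho> unfolding osgood_modulus_def by (intro strict_mono_onD[of "{0..}" \<rho> 0 r]) auto
      then have pos: "0 < \<rho> r" using \<rho> by (simp add: osgood_modulus_def)
      have lim: "(\<lambda>m. 1 / (1 / real (Suc m) + \<rho> r)) \<longlonglongrightarrow> 1 / (0 + \<rho> r)"
        using pos LIMSEQ_inverse_real_of_nat
        by (intro tendsto_divide tendsto_add tendsto_const) (simp_all add: inverse_eq_divide)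
      have "(\<lambda>m. ennreal (1 / (1 / real (Suc m) + \<rho> r))) \<longlonglongrightarrow> ennreal (1 / \<rho> r)"
        using tendsto_ennrealI[OF lim] by simp
      moreover have "f m r = ennreal (1 / (1 / real (Suc m) + \<rho> r))" for m
        using True by (simp add: f_def \<rho>'_def)
      ultimately have "(\<lambda>m. f m r) \<longlonglongrightarrow> ennreal (1 / \<rho> r)" by simp
      moreover have "(\<lambda>m. f m r) \<longlonglongrightarrow> (SUP m. f m r)"
        using inc by (intro LIMSEQ_SUP) (auto simp: incseq_def le_fun_def)
      ultimately have "ennreal (1 / \<rho> r) = (SUP m. f m r)" by (rule LIMSEQ_unique)
      then show ?thesis using True by simp
    qed simp
  qed
  also have "\<dots> = (SUP m. \<integral>\<^sup>+r. f m r \<partial>lborel)"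
    by (intro nn_integral_monotone_convergence_SUP inc) auto
  also have "\<dots> \<le> ennreal B" by (intro SUP_least int_f)
  finally show False by (simp add: top_unique)
qed

section \<open>Borel versions and almost everywhere statements\<close>

lemma AE_conull_borel_set:
  assumes "AE x in M. P x"
  obtains G where "G \<in> sets M" "AE x in M. x \<in> G" "\<And>x. x \<in> G \<Longrightarrow> P x"
proof -
  obtain N where N: "\<And>x. x \<in> space M - N \<Longrightarrow> P x" "N \<in> null_sets M"
    using AE_E3[OF assms] by blast
  have "AE x in M. x \<in> space M - N" using AE_not_in[OF N(2)] by auto
  moreover have "space M - N \<in> sets M" using N(2) by auto
  ultimately show thesis using that N(1) by blast
qed

lemma lebesgue_measurable_borel_version:
  fixes f :: "'c::euclidean_space \<Rightarrow> 'b::euclidean_space"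
  assumes f: "f \<in> borel_measurable lebesgue"
  obtains f' where "f' \<in> borel_measurable borel" "AE x in lborel. f x = f' x"
proof -
  have "\<exists>f'\<in>borel_measurable lborel. AE x in lborel. f x \<bullet> i = f' x" for i
    using f by (intro completion_ex_borel_measurable_real) auto
  then obtain F where F: "\<And>i. F i \<in> borel_measurable lborel" "\<And>i. AE x in lborel. f x \<bullet> i = F i x"
    by metis
  show thesis
  proof (rule that)
    show "(\<lambda>x. \<Sum>i\<in>Basis. F i x *\<^sub>R i) \<in> borel_measurable borel"
      using F(1) by (intro borel_measurable_sum borel_measurable_scaleR) auto
    have "AE x in lborel. \<forall>i\<in>Basis. f x \<bullet> i = F i x"
      by (intro AE_finite_allI F(2)) simp
    then show "AE x in lborel. f x = (\<Sum>i\<in>Basis. F i x *\<^sub>R i)"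
    proof eventually_elim
      case (elim x)
      then have "(\<Sum>i\<in>Basis. F i x *\<^sub>R i) = (\<Sum>i\<in>Basis. (f x \<bullet> i) *\<^sub>R i)" by (intro sum.cong) auto
      then show ?case by (simp add: euclidean_representation)
    qed
  qed
qed

lemma space_time_borel_version:
  fixes f :: "real \<times> 'a::euclidean_space \<Rightarrow> 'b::euclidean_space"
  assumes f: "f \<in> borel_measurable (space_time_measure T)"
  obtains f' where "f' \<in> borel_measurable (borel \<Otimes>\<^sub>M borel)"
    "AE p in lborel. fst p \<in> {0..T} \<longrightarrow> f p = f' p"
proof -
  have S: "({0..T} \<times> UNIV :: (real \<times> 'a) set) \<in> sets lebesgue"
    by (intro sets_completionI_sets) (simp add: borel_Times)
  have "(\<lambda>p. indicator ({0..T} \<times> UNIV) p *\<^sub>R f p) \<in> borel_measurable lebesgue"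
    using f S unfolding space_time_measure_def by (subst (asm) borel_measurable_restrict_space_iff) auto
  from lebesgue_measurable_borel_version[OF this] obtain f' where
    f': "f' \<in> borel_measurable borel" "AE p in lborel. indicator ({0..T} \<times> UNIV) p *\<^sub>R f p = f' p" by blast
  show thesis
  proof (rule that)
    show "f' \<in> borel_measurable (borel \<Otimes>\<^sub>M borel)" using f'(1) by (simp add: borel_prod)
    show "AE p in lborel. fst p \<in> {0..T} \<longrightarrow> f p = f' p"
      using f'(2) by eventually_elim (auto simp: indicator_def split: if_splits)
  qed
qed

lemma space_time_AE_iff:
  "(AE p in space_time_measure T. P p) \<longleftrightarrow> (AE p in lborel. fst p \<in> {0..T} \<longrightarrow> P p)"
proof -
  have S: "({0..T} \<times> UNIV :: (real \<times> 'a::euclidean_space) set) \<in> sets lebesgue"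
    by (intro sets_completionI_sets) (simp add: borel_Times)
  show ?thesis
    unfolding space_time_measure_def using S
    by (subst AE_restrict_space_iff) (auto simp: AE_completion_iff mem_Times_iff)
qed

lemma abs_continuous_curve_imp_continuous:
  assumes "abs_continuous_curve c d f"
  shows "continuous_on {c..d} f"
  unfolding continuous_on_iff
proof (intro ballI allI impI)
  fix x e assume x: "x \<in> {c..d}" and e: "0 < (e::real)"
  obtain \<delta> where \<delta>: "\<delta> > 0" and *: "\<forall>(n::nat) \<alpha> \<beta>. (\<forall>i<n. c \<le> \<alpha> i \<and> \<alpha> i \<le> \<beta> i \<and> \<beta> i \<le> d) \<longrightarrow>
        (\<forall>i<n. \<forall>j<n. i \<noteq> j \<longrightarrow> {\<alpha> i<..<\<beta> i} \<inter> {\<alpha> j<..<\<beta> j} = {}) \<longrightarrow>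
        (\<Sum>i<n. \<beta> i - \<alpha> i) < \<delta> \<longrightarrow> (\<Sum>i<n. norm (f (\<beta> i) - f (\<alpha> i))) < e"
    using assms[unfolded abs_continuous_curve_def, rule_format, OF e] by (elim exE conjE)
  have **: "dist (f t) (f s) < e" if "c \<le> s" "s \<le> t" "t \<le> d" "t - s < \<delta>" for s t
    using *[THEN spec[of _ 1], THEN spec[of _ "\<lambda>_. s"], THEN spec[of _ "\<lambda>_. t"]] that
    by (simp add: dist_norm)
  show "\<exists>\<delta>>0. \<forall>x'\<in>{c..d}. dist x' x < \<delta> \<longrightarrow> dist (f x') (f x) < e"
  proof (intro exI[of _ \<delta>] conjI ballI impI \<delta>)
    fix x' assume "x' \<in> {c..d}" "dist x' x < \<delta>"
    then show "dist (f x') (f x) < e"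
      using **[of x x'] **[of x' x] x by (cases "x \<le> x'") (auto simp: dist_real_def dist_commute)
  qed
qed

text \<open>
  Only the maps \<open>X t\<close> are assumed measurable. Joint measurability comes from continuity in time: up to
  null sets, \<open>X\<close> is the limit of its values at the rational times \<open>\<lfloor>m t\<rfloor> / m\<close>.
\<close>

lemma flow_borel_version:
  fixes X :: "real \<Rightarrow> 'a::euclidean_space \<Rightarrow> 'a"
  assumes T: "0 \<le> T" and meas: "\<And>t. t \<in> {0..T} \<Longrightarrow> X t \<in> borel_measurable lebesgue"
    and cont: "AE x in lborel. continuous_on {0..T} (\<lambda>t. X t x)"
  obtains Y where "Y \<in> borel_measurable (borel \<Otimes>\<^sub>M borel)"
    "AE x in lborel. \<forall>t\<in>{0..T}. X t x = Y (t, x)"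
proof -
  \<comment> \<open>Times are clamped to \<open>[0,T]\<close> so that the approximation can be set up on all of \<open>\<real>\<close>.\<close>
  define c where "c = (\<lambda>t. max 0 (min T t))"
  have c: "c t \<in> {0..T}" for t using T by (simp add: c_def)
  have c_id: "t \<in> {0..T} \<Longrightarrow> c t = t" for t by (simp add: c_def)
  have cont_c: "continuous_on UNIV c" unfolding c_def by (intro continuous_intros)
  have "\<exists>Z. Z \<in> borel_measurable borel \<and> (AE x in lborel. X (c t) x = Z x)" for t
    using lebesgue_measurable_borel_version[OF meas[OF c]] by metis
  then obtain Z where Z [measurable]: "\<And>t. Z t \<in> borel_measurable borel"
    and ZX: "\<And>t. AE x in lborel. X (c t) x = Z t x" by metis
  have "AE x in lborel. \<forall>m::nat. \<forall>i::int. X (c (of_int i / Suc m)) x = Z (of_int i / Suc m) x"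
    unfolding AE_all_countable by (intro allI ZX)
  then have "AE x in lborel. continuous_on {0..T} (\<lambda>t. X t x) \<and>
      (\<forall>m::nat. \<forall>i::int. X (c (of_int i / Suc m)) x = Z (of_int i / Suc m) x)"
    using cont by eventually_elim auto
  then obtain G where G: "G \<in> sets lborel" "AE x in lborel. x \<in> G"
    and G_cont: "\<And>x. x \<in> G \<Longrightarrow> continuous_on {0..T} (\<lambda>t. X t x)"
    and G_Z: "\<And>x m i. x \<in> G \<Longrightarrow> X (c (of_int i / real (Suc m))) x = Z (of_int i / Suc m) x"
    by (rule AE_conull_borel_set) blast
  define Y where "Y = (\<lambda>(t, x). if x \<in> G then X (c t) x else x)"
  have G_m [measurable]: "G \<in> sets borel" using G(1) by simp
  show thesis
  proof (rule that)
    show "Y \<in> borel_measurable (borel \<Otimes>\<^sub>M borel)"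
    proof (rule borel_measurable_LIMSEQ_metric)
      fix m
      define q where "q = (\<lambda>p::real \<times> 'a. \<lfloor>real (Suc m) * fst p\<rfloor>)"
      have q: "q \<in> measurable (borel \<Otimes>\<^sub>M borel) (count_space UNIV)"
        unfolding q_def by measurable
      have "(\<lambda>p. Z (of_int (q p) / Suc m) (snd p)) \<in> borel_measurable (borel \<Otimes>\<^sub>M borel)"
        by (rule measurable_compose_countable'[OF _ q, where f = "\<lambda>i p. Z (of_int i / Suc m) (snd p)"])
          (auto intro!: measurable_compose[OF measurable_snd Z])
      moreover have "snd -` G \<inter> space (borel \<Otimes>\<^sub>M borel) \<in> sets (borel \<Otimes>\<^sub>M borel :: (real \<times> 'a) measure)"
        by (rule measurable_sets[OF measurable_snd G_m])
      then have "{p \<in> space (borel \<Otimes>\<^sub>M borel :: (real \<times> 'a) measure). snd p \<in> G} \<in> sets (borel \<Otimes>\<^sub>M borel)"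
        by (simp add: vimage_def space_pair_measure)
      ultimately show "(\<lambda>p. if snd p \<in> G then Z (of_int \<lfloor>real (Suc m) * fst p\<rfloor> / Suc m) (snd p) else snd p)
         \<in> borel_measurable (borel \<Otimes>\<^sub>M borel)"
        unfolding q_def by (intro measurable_If measurable_snd)
    next
      fix p :: "real \<times> 'a"
      obtain t x where p: "p = (t, x)" by (cases p)
      show "(\<lambda>m. if snd p \<in> G then Z (of_int \<lfloor>real (Suc m) * fst p\<rfloor> / Suc m) (snd p) else snd p)
        \<longlonglongrightarrow> Y p"
      proof (cases "x \<in> G")
        case True
        have "(\<lambda>m. of_int \<lfloor>real (Suc m) * t\<rfloor> / real (Suc m)) \<longlonglongrightarrow> t"
        proof (rule tendsto_sandwich)
          show "\<forall>\<^sub>F m in sequentially. t - 1 / real (Suc m) \<le> of_int \<lfloor>real (Suc m) * t\<rfloor> / real (Suc m)"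
          proof (intro always_eventually allI)
            fix m
            have "real (Suc m) * t - 1 \<le> of_int \<lfloor>real (Suc m) * t\<rfloor>" by linarith
            then have "(real (Suc m) * t - 1) / real (Suc m) \<le> of_int \<lfloor>real (Suc m) * t\<rfloor> / real (Suc m)"
              by (intro divide_right_mono) auto
            then show "t - 1 / real (Suc m) \<le> of_int \<lfloor>real (Suc m) * t\<rfloor> / real (Suc m)"
              by (simp add: diff_divide_distrib)
          qed
          show "\<forall>\<^sub>F m in sequentially. of_int \<lfloor>real (Suc m) * t\<rfloor> / real (Suc m) \<le> t"
          proof (intro always_eventually allI)
            fix m
            have "of_int \<lfloor>real (Suc m) * t\<rfloor> \<le> real (Suc m) * t" by linarith
            then have "of_int \<lfloor>real (Suc m) * t\<rfloor> / real (Suc m) \<le> (real (Suc m) * t) / real (Suc m)"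
              by (intro divide_right_mono) auto
            then show "of_int \<lfloor>real (Suc m) * t\<rfloor> / real (Suc m) \<le> t" by simp
          qed
          show "(\<lambda>m. t - 1 / real (Suc m)) \<longlonglongrightarrow> t"
            using tendsto_diff[OF tendsto_const[of t] LIMSEQ_inverse_real_of_nat] by (simp add: inverse_eq_divide)
        qed simp
        moreover have "continuous_on UNIV (\<lambda>t. X (c t) x)"
          by (rule continuous_on_compose2[OF G_cont[OF True] cont_c]) (use c in auto)
        then have "isCont (\<lambda>t. X (c t) x) t"
          by (simp add: continuous_on_eq_continuous_at)
        ultimately have "(\<lambda>m. X (c (of_int \<lfloor>real (Suc m) * t\<rfloor> / real (Suc m))) x) \<longlonglongrightarrow> X (c t) x"
          by (rule isCont_tendsto_compose[rotated])
        then show ?thesis using True by (simp add: p Y_def G_Z del: of_nat_Suc)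
      qed (simp add: p Y_def)
    qed
    show "AE x in lborel. \<forall>t\<in>{0..T}. X t x = Y (t, x)"
      using G(2) by eventually_elim (auto simp: Y_def c_id)
  qed
qed

lemma L1_loc_space_time_measurable:
  fixes g :: "real \<Rightarrow> 'a::euclidean_space \<Rightarrow> 'b::euclidean_space"
  assumes "g \<in> L1_loc T"
  shows "(\<lambda>(t, x). g t x) \<in> borel_measurable (space_time_measure T)"
proof -
  define f where "f = (\<lambda>(t, x). g t x)"
  have S: "({0..T} \<times> UNIV :: (real \<times> 'a) set) \<in> sets lebesgue"
    by (intro sets_completionI_sets) (simp add: borel_Times)
  have "(\<lambda>p. indicator ({0..T} \<times> UNIV) p *\<^sub>R f p) \<in> borel_measurable lebesgue"
  proof (rule borel_measurable_LIMSEQ_metric)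
    fix n
    have "set_integrable lebesgue ({0..T} \<times> ball 0 (real (Suc n))) f"
      using assms unfolding L1_loc_def f_def by auto
    then show "(\<lambda>p. indicator ({0..T} \<times> ball 0 (real (Suc n))) p *\<^sub>R f p) \<in> borel_measurable lebesgue"
      unfolding set_integrable_def by (rule borel_measurable_integrable)
  next
    fix p :: "real \<times> 'a"
    obtain t x where p: "p = (t, x)" by (cases p)
    obtain n0 where n0: "norm x < real n0" using reals_Archimedean2 by blast
    have "eventually (\<lambda>n. indicator ({0..T} \<times> ball 0 (real (Suc n))) p *\<^sub>R f p = indicator ({0..T} \<times> UNIV) p *\<^sub>R f p) sequentially"
      using eventually_ge_at_top[of n0] by eventually_elim (use n0 in \<open>auto simp: p indicator_def\<close>)
    then show "(\<lambda>n. indicator ({0..T} \<times> ball 0 (real (Suc n))) p *\<^sub>R f p) \<longlonglongrightarrow> indicator ({0..T} \<times> UNIV) p *\<^sub>R f p"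
      by (rule tendsto_eventually)
  qed
  then show ?thesis
    unfolding space_time_measure_def f_def[symmetric] using S by (subst borel_measurable_restrict_space_iff) auto
qed

lemma pred_lborel_pair_sets:
  fixes P :: "'a::euclidean_space \<times> 'b::euclidean_space \<Rightarrow> bool"
  assumes "Measurable.pred (borel \<Otimes>\<^sub>M borel) P"
  shows "{p \<in> space (lborel \<Otimes>\<^sub>M lborel). P p} \<in> sets (lborel \<Otimes>\<^sub>M lborel)"
proof -
  have "sets (lborel \<Otimes>\<^sub>M lborel) = sets (borel \<Otimes>\<^sub>M borel :: ('a \<times> 'b) measure)"
    by (intro sets_pair_measure_cong) auto
  then show ?thesis using assms by (simp add: pred_def space_pair_measure)
qed

lemma AE_lborel_commute:
  fixes P :: "'a::euclidean_space \<Rightarrow> 'b::euclidean_space \<Rightarrow> bool"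
  assumes "Measurable.pred (borel \<Otimes>\<^sub>M borel) (\<lambda>p. P (fst p) (snd p))"
    and "AE x in lborel. AE y in lborel. P x y"
  shows "AE y in lborel. AE x in lborel. P x y"
  using lborel_pair.AE_commute[OF pred_lborel_pair_sets[OF assms(1)]] assms(2) by simp

section \<open>Maps of bounded compression\<close>

lemma compressibility_nn_integral_le:
  fixes X :: "real \<Rightarrow> 'a::euclidean_space \<Rightarrow> 'a"
  assumes comp: "compressibility_constant T X L" and t: "t \<in> {0..T}"
    and f [measurable]: "f \<in> borel_measurable borel"
  shows "(\<integral>\<^sup>+x. f (X t x) \<partial>lborel) \<le> ennreal L * (\<integral>\<^sup>+x. f x \<partial>lborel)"
proof -
  have [measurable]: "X t \<in> borel_measurable lebesgue"
    and le: "distr lebesgue lborel (X t) \<le> scale_measure (ennreal L) lborel"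
    using comp t by (auto simp: compressibility_constant_def)
  have "(\<integral>\<^sup>+x. f (X t x) \<partial>lborel) = (\<integral>\<^sup>+x. f (X t x) \<partial>lebesgue)"
    by (simp add: nn_integral_completion)
  also have "\<dots> = (\<integral>\<^sup>+x. f x \<partial>distr lebesgue lborel (X t))"
    by (subst nn_integral_distr) auto
  also have "\<dots> \<le> (\<integral>\<^sup>+x. f x \<partial>scale_measure (ennreal L) lborel)"
    using le by (intro nn_integral_mono_measure) auto
  also have "\<dots> = ennreal L * (\<integral>\<^sup>+x. f x \<partial>lborel)"
    by (simp add: nn_integral_scale_measure)
  finally show ?thesis .
qed

text \<open>
  The facts of this context hold for a Borel map \<open>Y\<close> each of whose slices \<open>Y (t, \<cdot>)\<close> at times in \<open>[0,T]\<close> pushes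
  Lebesgue measure forward to at most \<open>L\<close> times itself. Such slices pull null sets back to null sets.
\<close>

context
  fixes T L :: real and Y :: "real \<times> 'a::euclidean_space \<Rightarrow> 'a"
  assumes Y [measurable]: "Y \<in> borel_measurable (borel \<Otimes>\<^sub>M borel)"
    and compress: "\<And>t f. t \<in> {0..T} \<Longrightarrow> f \<in> borel_measurable borel \<Longrightarrow>
      (\<integral>\<^sup>+x. f (Y (t, x)) \<partial>lborel) \<le> ennreal L * (\<integral>\<^sup>+x. f x \<partial>lborel)"
begin

lemma AE_pullback:
  assumes t: "t \<in> {0..T}" and P: "AE y in lborel. P y"
  shows "AE x in lborel. P (Y (t, x))"
proof -
  obtain N where N: "\<And>x. x \<notin> N \<Longrightarrow> P x" "N \<in> null_sets lborel"
    using AE_E3[OF P] by auto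
  have [measurable]: "N \<in> sets borel" using N(2) by auto
  have "(\<integral>\<^sup>+x. indicator N (Y (t, x)) \<partial>lborel) \<le> ennreal L * (\<integral>\<^sup>+x. indicator N x \<partial>lborel)"
    by (intro compress t) auto
  also have "\<dots> = 0" using N(2) by (simp add: null_setsD1)
  finally have "(\<integral>\<^sup>+x. indicator N (Y (t, x)) \<partial>lborel) = (0::ennreal)" by simp
  then have "AE x in lborel. indicator N (Y (t, x)) = (0::ennreal)"
    by (subst (asm) nn_integral_0_iff_AE) auto
  then show ?thesis
    by eventually_elim (use N(1) in \<open>auto simp: indicator_def split: if_splits\<close>)
qed

text \<open>
  A property of almost every point of space-time holds, for almost every starting point, along
  almost all of its trajectory.
\<close>

lemma AE_pullback_space_time:
  assumes P: "AE p in lborel. fst p \<in> {0..T} \<longrightarrow> P p"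
  shows "AE x in lborel. AE s in lborel. s \<in> {0..T} \<longrightarrow> P (s, Y (s, x))"
proof -
  obtain N where N: "\<And>p. p \<notin> N \<Longrightarrow> fst p \<in> {0..T} \<longrightarrow> P p" "N \<in> null_sets lborel"
    using AE_E3[OF P] by auto
  have "N \<in> sets borel" using null_setsD2[OF N(2)] by simp
  then have N_m [measurable]: "N \<in> sets (borel \<Otimes>\<^sub>M borel)" by (simp only: borel_prod)
  have "AE p in lborel \<Otimes>\<^sub>M lborel. p \<notin> N"
    unfolding lborel_prod by (rule AE_not_in[OF N(2)])
  from lborel_pair.AE_pair[OF this] have "AE s in lborel. AE y in lborel. (s, y) \<notin> N" .
  then have "AE s in lborel. AE x in lborel. s \<in> {0..T} \<longrightarrow> (s, Y (s, x)) \<notin> N"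
  proof eventually_elim
    case (elim s)
    show ?case using AE_pullback[OF _ elim] by (cases "s \<in> {0..T}") auto
  qed
  then have "AE x in lborel. AE s in lborel. s \<in> {0..T} \<longrightarrow> (s, Y (s, x)) \<notin> N"
    by (rule AE_lborel_commute[rotated]) measurable
  then show ?thesis
    by (rule eventually_mono) (erule eventually_mono, use N(1) in fastforce)
qed

text \<open>
  The exceptional sets \<open>N s\<close> need not depend measurably on \<open>s\<close>; it is the relation \<open>Q\<close> that has to
  be Borel for Fubini's theorem to apply.
\<close>

lemma AE_pullback_pairs:
  assumes Q [measurable]: "Measurable.pred (borel \<Otimes>\<^sub>M (borel \<Otimes>\<^sub>M borel)) (\<lambda>(s, x, y). Q s x y)"
    and P: "AE s in lborel. s \<in> {0..T} \<longrightarrow> (\<exists>P. (AE x in lborel. P x) \<and> (\<forall>x y. P x \<longrightarrow> P y \<longrightarrow> Q s x y))"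
  shows "AE x in lborel. AE y in lborel. AE s in lborel. s \<in> {0..T} \<longrightarrow> Q s (Y (s, x)) (Y (s, y))"
proof -
  have Q' [measurable]: "Measurable.pred (borel \<Otimes>\<^sub>M (borel \<Otimes>\<^sub>M borel)) (\<lambda>(s, x, y). s \<in> {0..T} \<longrightarrow> Q s (Y (s, x)) (Y (s, y)))"
  proof -
    have "(\<lambda>(s, x, y). (s, Y (s, x), Y (s, y))) \<in> measurable (borel \<Otimes>\<^sub>M (borel \<Otimes>\<^sub>M borel)) (borel \<Otimes>\<^sub>M (borel \<Otimes>\<^sub>M borel))"
      by measurable
    from measurable_compose[OF this Q]
    have [measurable]: "Measurable.pred (borel \<Otimes>\<^sub>M (borel \<Otimes>\<^sub>M borel)) (\<lambda>p. Q (fst p) (Y (fst p, fst (snd p))) (Y (fst p, snd (snd p))))"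
      by (simp add: split_beta')
    show ?thesis by (simp add: split_beta')
  qed
  have "AE s in lborel. AE x in lborel. AE y in lborel. s \<in> {0..T} \<longrightarrow> Q s (Y (s, x)) (Y (s, y))"
    using P
  proof eventually_elim
    case (elim s)
    show ?case
    proof (cases "s \<in> {0..T}")
      case True
      then obtain P where P: "AE x in lborel. P x" and PQ: "\<And>x y. P x \<Longrightarrow> P y \<Longrightarrow> Q s x y" using elim by auto
      have *: "AE x in lborel. P (Y (s, x))" by (rule AE_pullback[OF True P])
      show ?thesis using *
      proof eventually_elim
        case (elim x)
        show ?case using * by eventually_elim (use elim PQ in auto)
      qed
    qed auto
  qed
  then have "AE s in lborel. AE p in lborel. s \<in> {0..T} \<longrightarrow> Q s (Y (s, fst p)) (Y (s, snd p))"
  proof eventually_elim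
    case (elim s)
    have "(\<lambda>p. (s, p)) \<in> measurable (borel \<Otimes>\<^sub>M borel) (borel \<Otimes>\<^sub>M (borel \<Otimes>\<^sub>M borel))"
      by measurable
    from measurable_compose[OF this Q']
    have "Measurable.pred (borel \<Otimes>\<^sub>M borel) (\<lambda>p. s \<in> {0..T} \<longrightarrow> Q s (Y (s, fst p)) (Y (s, snd p)))"
      by (simp add: split_beta')
    then have "AE p in lborel \<Otimes>\<^sub>M lborel. s \<in> {0..T} \<longrightarrow> Q s (Y (s, fst p)) (Y (s, snd p))"
      by (rule lborel_pair.AE_pair_measure[OF pred_lborel_pair_sets]) (use elim in simp)
    then show ?case unfolding lborel_prod .
  qed
  then have "AE p in lborel. AE s in lborel. s \<in> {0..T} \<longrightarrow> Q s (Y (s, fst p)) (Y (s, snd p))"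
    by (rule AE_lborel_commute[rotated]) (use Q' in \<open>simp add: borel_prod split_beta'\<close>)
  then have "AE p in lborel \<Otimes>\<^sub>M lborel. AE s in lborel. s \<in> {0..T} \<longrightarrow> Q s (Y (s, fst p)) (Y (s, snd p))"
    unfolding lborel_prod .
  from lborel_pair.AE_pair[OF this] show ?thesis by simp
qed

end

section \<open>The Osgood estimate along trajectories\<close>

lemma bounded_borel_set_integrable:
  fixes f :: "real \<Rightarrow> 'b::euclidean_space"
  assumes [measurable]: "f \<in> borel_measurable borel" and bound: "\<And>s. norm (f s) \<le> M"
  shows "set_integrable lborel {a..b} f"
  unfolding set_integrable_def
  by (rule integrableI_bounded_set_indicator[where B=M]) (auto simp: bound emeasure_lborel_Icc_eq)

lemma integral_diff_Icc:
  fixes f :: "real \<Rightarrow> 'b::euclidean_space"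
  assumes f: "set_integrable lborel {0..T} f" and st: "0 \<le> s" "s \<le> t" "t \<le> T"
  shows "integral {0..t} f - integral {0..s} f = (LINT u:{s..t}|lborel. f u)"
proof -
  have i: "set_integrable lborel {a..b} f" if "0 \<le> a" "b \<le> T" for a b
    using that by (intro set_integrable_subset[OF f]) auto
  have "integral {0..s} f + integral {s..t} f = integral {0..t} f"
    using st by (intro Henstock_Kurzweil_Integration.integral_combine set_borel_integral_eq_integral i) auto
  then show ?thesis
    using st set_borel_integral_eq_integral(2)[OF i, of s t] by (simp add: algebra_simps)
qed

lemma bounded_primitive_Lipschitz:
  fixes f :: "real \<Rightarrow> 'b::euclidean_space"
  assumes f: "f \<in> borel_measurable borel" "\<And>s. norm (f s) \<le> M"
    and y: "\<And>t. t \<in> {0..T} \<Longrightarrow> y t = x + integral {0..t} f"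
    and st: "s \<in> {0..T}" "t \<in> {0..T}"
  shows "norm (y t - y s) \<le> M * \<bar>t - s\<bar>"
proof -
  have *: "norm (y t - y s) \<le> M * (t - s)" if "0 \<le> s" "s \<le> t" "t \<le> T" for s t
  proof -
    have "y t - y s = (LINT u:{s..t}|lborel. f u)"
      using integral_diff_Icc[OF bounded_borel_set_integrable[OF f] that] y[of t] y[of s] that by simp
    also have "norm \<dots> \<le> (LINT u:{s..t}|lborel. norm (f u))"
      by (rule set_integral_norm_bound[OF bounded_borel_set_integrable[OF f]])
    also have "\<dots> \<le> (LINT u:{s..t}|lborel. M)"
      using f by (intro set_integral_mono set_integrable_norm bounded_borel_set_integrable[OF f])
        (auto intro: bounded_borel_set_integrable[where M="norm M"])
    also have "\<dots> = M * (t - s)" using that by (simp add: set_lebesgue_integral_def)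
    finally show ?thesis .
  qed
  show ?thesis using *[of s t] *[of t s] st by (cases "s \<le> t") (auto simp: norm_minus_commute)
qed

text \<open>
  The Osgood estimate for two curves with bounded Borel velocities \<open>f1\<close> and \<open>f2\<close> whose difference
  is controlled by \<open>\<rho>\<close> of the distance.
\<close>

lemma osgood_two_curves:
  fixes f1 f2 y1 y2 :: "real \<Rightarrow> 'b::euclidean_space"
  assumes \<rho>: "osgood_modulus \<rho>" and \<delta>: "0 < \<delta>" and T: "0 \<le> T"
    and f1: "f1 \<in> borel_measurable borel" "\<And>s. norm (f1 s) \<le> M"
    and f2: "f2 \<in> borel_measurable borel" "\<And>s. norm (f2 s) \<le> M"
    and y1: "\<And>t. t \<in> {0..T} \<Longrightarrow> y1 t = x1 + integral {0..t} f1"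
    and y2: "\<And>t. t \<in> {0..T} \<Longrightarrow> y2 t = x2 + integral {0..t} f2"
    and \<gamma> [measurable]: "\<gamma> \<in> borel_measurable borel" and \<gamma>_nonneg: "\<And>s. 0 \<le> \<gamma> s"
    and \<gamma>_fin: "(\<integral>\<^sup>+s\<in>{0..T}. ennreal (\<gamma> s) \<partial>lborel) < \<infinity>"
    and diff: "AE s in lborel. s \<in> {0..T} \<longrightarrow> norm (f1 s - f2 s) \<le> \<gamma> s * \<rho> (norm (y1 s - y2 s))"
    and t: "t \<in> {0..T}"
  shows "osgood_primitive \<rho> \<delta> (norm (y1 t - y2 t))
    \<le> osgood_primitive \<rho> \<delta> (norm (x1 - x2)) + enn2real (\<integral>\<^sup>+s\<in>{0..T}. ennreal (\<gamma> s) \<partial>lborel)"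
proof -
  have nn_eq: "(\<integral>\<^sup>+s. ennreal (indicator {0..T} s *\<^sub>R \<gamma> s) \<partial>lborel) = (\<integral>\<^sup>+s\<in>{0..T}. ennreal (\<gamma> s) \<partial>lborel)"
    by (intro nn_integral_cong) (auto simp: indicator_def)
  have \<gamma>_int: "set_integrable lborel {0..T} \<gamma>"
    unfolding set_integrable_def
  proof (rule integrableI_nonneg)
    show "(\<integral>\<^sup>+s. ennreal (indicator {0..T} s *\<^sub>R \<gamma> s) \<partial>lborel) < \<infinity>"
      using \<gamma>_fin by (simp only: nn_eq)
  qed (auto simp: \<gamma>_nonneg)
  have \<gamma>_sub: "set_integrable lborel {a..b} \<gamma>" if "0 \<le> a" "b \<le> T" for a b
    using that by (intro set_integrable_subset[OF \<gamma>_int]) auto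
  define h where "h = (\<lambda>t. norm (y1 t - y2 t))"
  define \<Gamma> where "\<Gamma> = (\<lambda>t. integral {0..t} \<gamma>)"
  have \<Gamma>_diff: "\<Gamma> t - \<Gamma> s = (LINT u:{s..t}|lborel. \<gamma> u)" if "0 \<le> s" "s \<le> t" "t \<le> T" for s t
    unfolding \<Gamma>_def by (rule integral_diff_Icc[OF \<gamma>_int that])
  have cont: "continuous_on {0..T} y"
    if f: "f \<in> borel_measurable borel" "\<And>s. norm (f s) \<le> M"
    and y: "\<And>t. t \<in> {0..T} \<Longrightarrow> y t = x + integral {0..t} f" for f y and x :: 'b
  proof -
    have "0 \<le> M" using f(2)[of 0] norm_ge_zero order_trans by blast
    then have "M-lipschitz_on {0..T} y"
      using bounded_primitive_Lipschitz[OF f y] by (intro lipschitz_onI) (auto simp: dist_norm dist_real_def)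
    then show ?thesis by (rule lipschitz_on_continuous_on)
  qed
  have "osgood_primitive \<rho> \<delta> (h t) \<le> osgood_primitive \<rho> \<delta> (h 0) + (\<Gamma> t - \<Gamma> 0)"
  proof (rule osgood_comparison[OF \<rho> \<delta>, where T = T])
    show "continuous_on {0..T} h"
      unfolding h_def by (intro continuous_intros cont[OF f1 y1] cont[OF f2 y2])
    show "0 \<le> h t" for t by (simp add: h_def)
    show "\<Gamma> s \<le> \<Gamma> t" if "0 \<le> s" "s \<le> t" "t \<le> T" for s t
    proof -
      have "0 \<le> (LINT u:{s..t}|lborel. \<gamma> u)"
        unfolding set_lebesgue_integral_def by (intro integral_nonneg_AE) (auto simp: \<gamma>_nonneg)
      then show ?thesis using \<Gamma>_diff[OF that] by simp
    qed
    show "h t - h s \<le> c * (\<Gamma> t - \<Gamma> s)"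
      if st: "0 \<le> s" "s \<le> t" "t \<le> T" and c: "\<And>u. s \<le> u \<Longrightarrow> u \<le> t \<Longrightarrow> \<rho> (h u) \<le> c" for s t c
    proof -
      have i1: "set_integrable lborel {s..t} f1" and i2: "set_integrable lborel {s..t} f2"
        by (intro bounded_borel_set_integrable[OF f1] bounded_borel_set_integrable[OF f2])+
      have e1: "y1 t - y1 s = (LINT u:{s..t}|lborel. f1 u)"
        using integral_diff_Icc[OF bounded_borel_set_integrable[OF f1] st] y1[of t] y1[of s] st by simp
      have e2: "y2 t - y2 s = (LINT u:{s..t}|lborel. f2 u)"
        using integral_diff_Icc[OF bounded_borel_set_integrable[OF f2] st] y2[of t] y2[of s] st by simp
      have "h t - h s \<le> norm ((y1 t - y2 t) - (y1 s - y2 s))"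
        unfolding h_def by (rule norm_triangle_ineq2)
      also have "(y1 t - y2 t) - (y1 s - y2 s) = (LINT u:{s..t}|lborel. f1 u - f2 u)"
        using e1 e2 set_integral_diff(2)[OF i1 i2] by (simp add: algebra_simps)
      also have "norm \<dots> \<le> (LINT u:{s..t}|lborel. norm (f1 u - f2 u))"
        by (intro set_integral_norm_bound set_integral_diff i1 i2)
      also have "\<dots> \<le> (LINT u:{s..t}|lborel. c * \<gamma> u)"
      proof (rule set_integral_mono_AE)
        show "set_integrable lborel {s..t} (\<lambda>u. norm (f1 u - f2 u))"
          by (intro set_integrable_norm set_integral_diff i1 i2)
        show "set_integrable lborel {s..t} (\<lambda>u. c * \<gamma> u)"
          using \<gamma>_sub[of s t] st by (intro set_integrable_mult_right) auto
        show "AE u \<in> {s..t} in lborel. norm (f1 u - f2 u) \<le> c * \<gamma> u"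
          using diff
        proof eventually_elim
          case (elim u)
          show ?case
          proof
            assume u: "u \<in> {s..t}"
            then have "norm (f1 u - f2 u) \<le> \<gamma> u * \<rho> (h u)" using elim st by (auto simp: h_def)
            also have "\<dots> \<le> \<gamma> u * c" using c[of u] u \<gamma>_nonneg by (intro mult_left_mono) auto
            finally show "norm (f1 u - f2 u) \<le> c * \<gamma> u" by (simp add: mult.commute)
          qed
        qed
      qed
      also have "\<dots> = c * (LINT u:{s..t}|lborel. \<gamma> u)" by (rule set_integral_mult_right)
      finally show ?thesis using \<Gamma>_diff[OF st] by simp
    qed
  qed (use t in auto)
  also have "h 0 = norm (x1 - x2)" using y1[of 0] y2[of 0] T by (simp add: h_def)
  also have "\<Gamma> t - \<Gamma> 0 \<le> enn2real (\<integral>\<^sup>+s\<in>{0..T}. ennreal (\<gamma> s) \<partial>lborel)"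
  proof -
    have "\<Gamma> t - \<Gamma> 0 = (LINT u:{0..t}|lborel. \<gamma> u)" using \<Gamma>_diff[of 0 t] t by simp
    also have "\<dots> \<le> (LINT u:{0..T}|lborel. \<gamma> u)"
      unfolding set_lebesgue_integral_def using t \<gamma>_sub[of 0 t] \<gamma>_int
      by (intro integral_mono) (auto simp: set_integrable_def \<gamma>_nonneg indicator_def)
    also have "\<dots> = enn2real (\<integral>\<^sup>+s. ennreal (indicator {0..T} s *\<^sub>R \<gamma> s) \<partial>lborel)"
      unfolding set_lebesgue_integral_def by (intro integral_eq_nn_integral) (auto simp: \<gamma>_nonneg)
    also have "\<dots> = enn2real (\<integral>\<^sup>+s\<in>{0..T}. ennreal (\<gamma> s) \<partial>lborel)"
      by (simp only: nn_eq)
    finally show ?thesis .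
  qed
  finally show ?thesis by (simp add: h_def)
qed

text \<open>
  What the compactness argument uses of a flow with velocity at most \<open>M\<close>, after modification on a
  null set of initial points. \<open>G x\<close> plays the role of the integral over time of \<open>g\<close> along the
  trajectory of \<open>x\<close>; it may be infinite.
\<close>

definition osgood_flow ::
    "real \<Rightarrow> real \<Rightarrow> (real \<Rightarrow> real) \<Rightarrow> (real \<times> 'a::euclidean_space \<Rightarrow> 'a) \<Rightarrow> ('a \<Rightarrow> ennreal) \<Rightarrow> bool" where
  "osgood_flow T M \<rho> Y G \<longleftrightarrow>
     Y \<in> borel_measurable (borel \<Otimes>\<^sub>M borel) \<and> G \<in> borel_measurable borel \<and> (\<forall>x. Y (0, x) = x) \<and>
     (\<forall>s\<in>{0..T}. \<forall>t\<in>{0..T}. \<forall>x. norm (Y (t, x) - Y (s, x)) \<le> M * \<bar>t - s\<bar>) \<and>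
     (AE x in lborel. AE y in lborel. \<forall>t\<in>{0..T}. \<forall>\<delta>>0.
       ennreal (osgood_primitive \<rho> \<delta> (norm (Y (t, x) - Y (t, y))))
         \<le> ennreal (osgood_primitive \<rho> \<delta> (norm (x - y))) + G x + G y)"

text \<open>
  Regular Lagrangian flows of bounded fields satisfying (H) are of this kind. The proof replaces \<open>b\<close>, \<open>g\<close> and \<open>X\<close> by Borel versions, so
  that condition (H) along pairs of trajectories becomes a Borel condition on \<open>(s, x, y)\<close>, and
  exchanges "for almost every \<open>s\<close>" with "for almost every \<open>(x, y)\<close>".
\<close>

lemma flow_osgood_estimate:
  fixes X :: "real \<Rightarrow> 'a::euclidean_space \<Rightarrow> 'a"
  assumes T: "0 < T" and \<rho>: "osgood_modulus \<rho>" and M: "0 \<le> M" "Linf_norm T b \<le> ennreal M"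
    and H: "condition_H T \<rho> b g" and flow: "regular_lagrangian_flow T b X"
    and comp: "compressibility_constant T X L"
  obtains Y G where "osgood_flow T M \<rho> Y G" "AE x in lborel. \<forall>t\<in>{0..T}. X t x = Y (t, x)"
    "\<And>R. (\<integral>\<^sup>+x\<in>ball 0 R. G x \<partial>lborel) \<le> ennreal L * L1_norm T (R + M * T) g"
proof -
  have X_AE: "AE x in lborel. abs_continuous_curve 0 T (\<lambda>t. X t x) \<and>
        set_integrable lebesgue {0..T} (\<lambda>s. b s (X s x)) \<and>
        (\<forall>t\<in>{0..T}. X t x = x + (LINT s:{0..t}|lebesgue. b s (X s x)))"
    using flow unfolding regular_lagrangian_flow_def by (simp add: AE_completion_iff)
  have X_cont: "AE x in lborel. continuous_on {0..T} (\<lambda>t. X t x)"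
    using X_AE by eventually_elim (auto intro: abs_continuous_curve_imp_continuous)
  have X_meas: "X t \<in> borel_measurable lebesgue" if "t \<in> {0..T}" for t
    using comp that by (auto simp: compressibility_constant_def)
  obtain Y0 where Y0 [measurable]: "Y0 \<in> borel_measurable (borel \<Otimes>\<^sub>M borel)"
    and XY0: "AE x in lborel. \<forall>t\<in>{0..T}. X t x = Y0 (t, x)"
    by (rule flow_borel_version[OF less_imp_le[OF T] X_meas X_cont])

  obtain b0 where b0 [measurable]: "b0 \<in> borel_measurable (borel \<Otimes>\<^sub>M borel)"
    and bb0: "AE p in lborel. fst p \<in> {0..T} \<longrightarrow> (\<lambda>(t, x). b t x) p = b0 p"
    using H unfolding condition_H_def by (elim conjE) (rule space_time_borel_version)
  have bM: "AE p in lborel. fst p \<in> {0..T} \<longrightarrow> norm (b (fst p) (snd p)) \<le> M"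
  proof -
    have "AE p in space_time_measure T. (\<lambda>(t, x). ennreal (norm (b t x))) p \<le> ennreal M"
      using M(2) unfolding Linf_norm_def by (intro eventually_mono[OF esssup_AE]) (rule order_trans)
    then show ?thesis
      unfolding space_time_AE_iff by (rule eventually_mono) (use M(1) in \<open>auto simp: split_beta\<close>)
  qed
  \<comment> \<open>Truncation makes the Borel version bounded everywhere and not only almost everywhere.\<close>
  define b' where "b' = (\<lambda>p. if norm (b0 p) \<le> M then b0 p else 0)"
  have b'_m [measurable]: "b' \<in> borel_measurable (borel \<Otimes>\<^sub>M borel)" unfolding b'_def by measurable
  have b'_M: "norm (b' p) \<le> M" for p using M(1) by (simp add: b'_def)
  have bb': "AE p in lborel. fst p \<in> {0..T} \<longrightarrow> b (fst p) (snd p) = b' p"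
    using bb0 bM by eventually_elim (auto simp: b'_def split_beta)

  have g_L1: "g \<in> L1_loc T" and g_nonneg: "\<And>t x. t \<in> {0..T} \<Longrightarrow> 0 \<le> g t x"
    using H unfolding condition_H_def by auto
  obtain g0 where g0 [measurable]: "g0 \<in> borel_measurable (borel \<Otimes>\<^sub>M borel)"
    and gg0: "AE p in lborel. fst p \<in> {0..T} \<longrightarrow> (\<lambda>(t, x). g t x) p = g0 p"
    by (rule space_time_borel_version[OF L1_loc_space_time_measurable[OF g_L1]])
  define g' where "g' = (\<lambda>p. max 0 (g0 p))"
  have g'_m [measurable]: "g' \<in> borel_measurable (borel \<Otimes>\<^sub>M borel)" unfolding g'_def by measurable
  have g'_nonneg: "0 \<le> g' p" for p by (simp add: g'_def)
  have gg': "AE p in lborel. fst p \<in> {0..T} \<longrightarrow> g (fst p) (snd p) = g' p"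
    using gg0
  proof eventually_elim
    case (elim p)
    then show ?case using g_nonneg[of "fst p" "snd p"] by (simp add: g'_def split_beta)
  qed

  have compress0: "(\<integral>\<^sup>+x. f (Y0 (t, x)) \<partial>lborel) \<le> ennreal L * (\<integral>\<^sup>+x. f x \<partial>lborel)"
    if "t \<in> {0..T}" "f \<in> borel_measurable borel" for t f
  proof -
    have "(\<integral>\<^sup>+x. f (Y0 (t, x)) \<partial>lborel) = (\<integral>\<^sup>+x. f (X t x) \<partial>lborel)"
      using XY0 by (intro nn_integral_cong_AE, eventually_elim) (use that in auto)
    with compressibility_nn_integral_le[OF comp that] show ?thesis by simp
  qed

  have "AE x in lborel. AE s in lborel. s \<in> {0..T} \<longrightarrow> b s (Y0 (s, x)) = b' (s, Y0 (s, x))"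
  proof -
    have "AE x in lborel. AE s in lborel. s \<in> {0..T} \<longrightarrow>
        (\<lambda>p. b (fst p) (snd p) = b' p) (s, Y0 (s, x))"
      by (rule AE_pullback_space_time[where L = L, OF Y0 _ bb']) (rule compress0)
    then show ?thesis by simp
  qed
  then have "AE x in lborel. \<forall>t\<in>{0..T}. X t x = Y0 (t, x) \<and>
      Y0 (t, x) = x + integral {0..t} (\<lambda>s. b' (s, Y0 (s, x)))"
    using X_AE XY0
  proof eventually_elim
    case (elim x)
    obtain N where N: "\<And>s. s \<in> space lborel - N \<Longrightarrow> s \<in> {0..T} \<longrightarrow> b s (Y0 (s, x)) = b' (s, Y0 (s, x))"
      "N \<in> null_sets lborel"
      using AE_E3[OF elim(1)] by blast
    have N_negl: "negligible N" using N(2) by (simp add: negligible_iff_null_sets null_sets_completionI)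
    show ?case
    proof (intro ballI conjI)
      fix t assume t: "t \<in> {0..T}"
      then show "X t x = Y0 (t, x)" using elim by auto
      have "set_integrable lebesgue {0..T} (\<lambda>s. b s (X s x))" using elim(2) by blast
      then have "set_integrable lebesgue {0..t} (\<lambda>s. b s (X s x))"
        by (rule set_integrable_subset) (use t in simp_all)
      then have "(LINT s:{0..t}|lebesgue. b s (X s x)) = integral {0..t} (\<lambda>s. b s (X s x))"
        by (rule set_lebesgue_integral_eq_integral)
      also have "\<dots> = integral {0..t} (\<lambda>s. b' (s, Y0 (s, x)))"
        using N(1) elim(3) t by (intro integral_spike[OF N_negl]) auto
      finally show "Y0 (t, x) = x + integral {0..t} (\<lambda>s. b' (s, Y0 (s, x)))"
        using elim(2,3) t by simp
    qed
  qed
  then obtain G0 where G0 [measurable]: "G0 \<in> sets lborel" and G0_AE: "AE x in lborel. x \<in> G0"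
    and XG0: "\<And>x. x \<in> G0 \<Longrightarrow> \<forall>t\<in>{0..T}. X t x = Y0 (t, x) \<and>
      Y0 (t, x) = x + integral {0..t} (\<lambda>s. b' (s, Y0 (s, x)))"
    by (rule AE_conull_borel_set) blast
  \<comment> \<open>Off the good set \<open>G0\<close> the curve is made constant, so that it is Lipschitz for every \<open>x\<close>.\<close>
  define Y where "Y = (\<lambda>(t, x). if x \<in> G0 then Y0 (t, x) else x)"
  have G0_borel [measurable]: "G0 \<in> sets borel" using G0 by simp
  have Y_m [measurable]: "Y \<in> borel_measurable (borel \<Otimes>\<^sub>M borel)"
    unfolding Y_def split_beta' by measurable
  have Y_G0: "x \<in> G0 \<Longrightarrow> Y (t, x) = Y0 (t, x)" for t x by (simp add: Y_def)
  have Y_int: "Y (t, x) = x + integral {0..t} (\<lambda>s. b' (s, Y (s, x)))" if "x \<in> G0" "t \<in> {0..T}" for t x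
    using XG0[OF that(1)] that by (simp add: Y_G0)
  have XY: "AE x in lborel. \<forall>t\<in>{0..T}. X t x = Y (t, x)"
    using G0_AE by eventually_elim (use XG0 Y_G0 in auto)
  have Y_0: "Y (0, x) = x" for x
    using Y_int[of x 0] T by (cases "x \<in> G0") (auto simp: Y_def)
  have f_m: "(\<lambda>s. b' (s, Y (s, x))) \<in> borel_measurable borel" for x by measurable
  have Y_Lip: "norm (Y (t, x) - Y (s, x)) \<le> M * \<bar>t - s\<bar>" if "s \<in> {0..T}" "t \<in> {0..T}" for s t x
  proof (cases "x \<in> G0")
    case True
    show ?thesis
      by (rule bounded_primitive_Lipschitz[OF f_m b'_M Y_int that]) (auto simp: True)
  next
    case False
    then show ?thesis using M by (simp add: Y_def)
  qed
  have compress: "(\<integral>\<^sup>+x. f (Y (t, x)) \<partial>lborel) \<le> ennreal L * (\<integral>\<^sup>+x. f x \<partial>lborel)"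
    if "t \<in> {0..T}" "f \<in> borel_measurable borel" for t f
  proof -
    have "(\<integral>\<^sup>+x. f (Y (t, x)) \<partial>lborel) = (\<integral>\<^sup>+x. f (Y0 (t, x)) \<partial>lborel)"
      using G0_AE by (intro nn_integral_cong_AE, eventually_elim) (simp add: Y_G0)
    with compress0[OF that] show ?thesis by simp
  qed

  \<comment> \<open>A continuous, hence Borel, extension of \<open>\<rho>\<close> from the half-line.\<close>
  define \<rho>' where "\<rho>' = (\<lambda>r. \<rho> (max 0 r))"
  have "continuous_on UNIV \<rho>'"
    unfolding \<rho>'_def
    by (rule continuous_on_compose2[OF osgood_modulus_continuous[OF \<rho>]]) (auto intro!: continuous_intros)
  then have [measurable]: "\<rho>' \<in> borel_measurable borel" by (rule borel_measurable_continuous_onI)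
  have Q: "AE x in lborel. AE y in lborel. AE s in lborel. s \<in> {0..T} \<longrightarrow>
      norm (b' (s, Y (s, x)) - b' (s, Y (s, y)))
        \<le> (g' (s, Y (s, x)) + g' (s, Y (s, y))) * \<rho>' (norm (Y (s, x) - Y (s, y)))"
  proof (rule AE_pullback_pairs[where L = L, OF Y_m])
    show "(\<integral>\<^sup>+x. f (Y (t, x)) \<partial>lborel) \<le> ennreal L * (\<integral>\<^sup>+x. f x \<partial>lborel)"
      if "t \<in> {0..T}" "f \<in> borel_measurable borel" for t f
      by (rule compress[OF that])
    show "Measurable.pred (borel \<Otimes>\<^sub>M (borel \<Otimes>\<^sub>M borel))
      (\<lambda>(s, x, y). norm (b' (s, x) - b' (s, y)) \<le> (g' (s, x) + g' (s, y)) * \<rho>' (norm (x - y)))"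
      by measurable
    obtain N where N: "\<And>t. t \<in> {0..T} \<Longrightarrow> negligible (N t)"
      "\<And>t x y. t \<in> {0..T} \<Longrightarrow> x \<notin> N t \<Longrightarrow> y \<notin> N t \<Longrightarrow>
        norm (b t x - b t y) \<le> (g t x + g t y) * \<rho> (norm (x - y))"
      using H unfolding condition_H_def by blast
    have "AE p in lborel \<Otimes>\<^sub>M lborel. fst p \<in> {0..T} \<longrightarrow> b (fst p) (snd p) = b' p \<and> g (fst p) (snd p) = g' p"
      unfolding lborel_prod using bb' gg' by eventually_elim auto
    from lborel_pair.AE_pair[OF this]
    show "AE s in lborel. s \<in> {0..T} \<longrightarrow> (\<exists>P. (AE x in lborel. P x) \<and> (\<forall>x y. P x \<longrightarrow> P y \<longrightarrow>
      norm (b' (s, x) - b' (s, y)) \<le> (g' (s, x) + g' (s, y)) * \<rho>' (norm (x - y))))"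
    proof eventually_elim
      case (elim s)
      show ?case
      proof
        assume s: "s \<in> {0..T}"
        have "AE x in lborel. x \<notin> N s"
          using AE_not_in[OF N(1)[OF s, unfolded negligible_iff_null_sets]] unfolding AE_completion_iff .
        then have "AE x in lborel. b s x = b' (s, x) \<and> g s x = g' (s, x) \<and> x \<notin> N s"
          using elim by eventually_elim (use s in simp)
        moreover have "norm (b' (s, x) - b' (s, y)) \<le> (g' (s, x) + g' (s, y)) * \<rho>' (norm (x - y))"
          if "b s x = b' (s, x) \<and> g s x = g' (s, x) \<and> x \<notin> N s"
            "b s y = b' (s, y) \<and> g s y = g' (s, y) \<and> y \<notin> N s" for x y
          using N(2)[OF s, of x y] that by (simp add: \<rho>'_def)
        ultimately show "\<exists>P. (AE x in lborel. P x) \<and> (\<forall>x y. P x \<longrightarrow> P y \<longrightarrow>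
          norm (b' (s, x) - b' (s, y)) \<le> (g' (s, x) + g' (s, y)) * \<rho>' (norm (x - y)))"
          by (intro exI[of _ "\<lambda>x. b s x = b' (s, x) \<and> g s x = g' (s, x) \<and> x \<notin> N s"] conjI allI impI)
      qed
    qed
  qed

  define G where "G = (\<lambda>x. \<integral>\<^sup>+s\<in>{0..T}. ennreal (g' (s, Y (s, x))) \<partial>lborel)"
  have G_m [measurable]: "G \<in> borel_measurable borel" unfolding G_def by measurable
  have G_bound: "(\<integral>\<^sup>+x\<in>ball 0 R. G x \<partial>lborel) \<le> ennreal L * L1_norm T (R + M * T) g" for R
  proof -
    let ?B = "ball (0::'a) (R + M * T)"
    have [measurable]: "ball c r \<in> sets borel" for c :: 'a and r by simp
    have meas: "(\<lambda>(x, s). ennreal (g' (s, Y (s, x))) * indicator {0..T} s * indicator (ball 0 R) x) \<in> borel_measurable (borel \<Otimes>\<^sub>M borel)"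
      by measurable
    have meas': "(\<lambda>p. ennreal (g' p) * indicator ({0..T} \<times> ?B) p) \<in> borel_measurable (lborel \<Otimes>\<^sub>M lborel)"
      unfolding indicator_times by measurable
    have "(\<integral>\<^sup>+x\<in>ball 0 R. G x \<partial>lborel)
        = (\<integral>\<^sup>+x. \<integral>\<^sup>+s. ennreal (g' (s, Y (s, x))) * indicator {0..T} s * indicator (ball 0 R) x \<partial>lborel \<partial>lborel)"
      unfolding G_def by (intro nn_integral_cong nn_integral_multc[symmetric]) measurable
    also have "\<dots> = (\<integral>\<^sup>+s. \<integral>\<^sup>+x. ennreal (g' (s, Y (s, x))) * indicator {0..T} s * indicator (ball 0 R) x \<partial>lborel \<partial>lborel)"
      by (intro lborel_pair.Fubini'[symmetric]) (use meas in \<open>simp cong: measurable_cong_sets sets_pair_measure_cong\<close>)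
    also have "\<dots> \<le> (\<integral>\<^sup>+s. ennreal L * (\<integral>\<^sup>+y. ennreal (g' (s, y)) * indicator ({0..T} \<times> ?B) (s, y) \<partial>lborel) \<partial>lborel)"
    proof (intro nn_integral_mono)
      fix s
      show "(\<integral>\<^sup>+x. ennreal (g' (s, Y (s, x))) * indicator {0..T} s * indicator (ball 0 R) x \<partial>lborel)
        \<le> ennreal L * (\<integral>\<^sup>+y. ennreal (g' (s, y)) * indicator ({0..T} \<times> ?B) (s, y) \<partial>lborel)"
      proof (cases "s \<in> {0..T}")
        case True
        have in_ball: "Y (s, x) \<in> ?B" if "x \<in> ball 0 R" for x
        proof -
          have "norm (Y (s, x) - Y (0, x)) \<le> M * \<bar>s - 0\<bar>" using True T by (intro Y_Lip) auto
          also have "\<dots> \<le> M * T" using True M by (intro mult_left_mono) auto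
          finally have "norm (Y (s, x) - x) \<le> M * T" by (simp add: Y_0)
          moreover have "norm (Y (s, x)) \<le> norm x + norm (Y (s, x) - x)" by (metis add_diff_cancel_left' diff_add_cancel norm_triangle_ineq)
          ultimately show ?thesis using that by simp
        qed
        have "(\<integral>\<^sup>+x. ennreal (g' (s, Y (s, x))) * indicator {0..T} s * indicator (ball 0 R) x \<partial>lborel)
          \<le> (\<integral>\<^sup>+x. ennreal (g' (s, Y (s, x))) * indicator ?B (Y (s, x)) \<partial>lborel)"
          using in_ball by (intro nn_integral_mono) (auto simp: indicator_def)
        also have "\<dots> \<le> ennreal L * (\<integral>\<^sup>+y. ennreal (g' (s, y)) * indicator ?B y \<partial>lborel)"
          by (rule compress[OF True, of "\<lambda>y. ennreal (g' (s, y)) * indicator ?B y"]) measurable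
        finally show ?thesis using True by (simp add: indicator_times)
      qed simp
    qed
    also have "\<dots> = ennreal L * (\<integral>\<^sup>+s. \<integral>\<^sup>+y. ennreal (g' (s, y)) * indicator ({0..T} \<times> ?B) (s, y) \<partial>lborel \<partial>lborel)"
      by (intro nn_integral_cmult) (simp add: indicator_times)
    also have "(\<integral>\<^sup>+s. \<integral>\<^sup>+y. ennreal (g' (s, y)) * indicator ({0..T} \<times> ?B) (s, y) \<partial>lborel \<partial>lborel)
        = (\<integral>\<^sup>+p. ennreal (g' p) * indicator ({0..T} \<times> ?B) p \<partial>lborel)"
      using lborel.nn_integral_fst[OF meas'] unfolding lborel_prod .
    also have "\<dots> = L1_norm T (R + M * T) g"
      unfolding L1_norm_def nn_integral_completion
      using gg' by (intro nn_integral_cong_AE, eventually_elim) (auto simp: indicator_def g'_nonneg split_beta)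
    finally show ?thesis .
  qed

  have pair: "AE x in lborel. AE y in lborel. \<forall>t\<in>{0..T}. \<forall>\<delta>>0.
       ennreal (osgood_primitive \<rho> \<delta> (norm (Y (t, x) - Y (t, y))))
         \<le> ennreal (osgood_primitive \<rho> \<delta> (norm (x - y))) + G x + G y"
    using Q G0_AE
  proof eventually_elim
    case (elim x)
    note x = elim(2)
    from elim(1) G0_AE show ?case
    proof eventually_elim
      case (elim y)
      show ?case
      proof (intro ballI allI impI)
        fix t \<delta> :: real assume t: "t \<in> {0..T}" and \<delta>: "0 < \<delta>"
        define \<gamma> where "\<gamma> = (\<lambda>s. g' (s, Y (s, x)) + g' (s, Y (s, y)))"
        have \<gamma>_m [measurable]: "\<gamma> \<in> borel_measurable borel" unfolding \<gamma>_def by measurable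
        have \<gamma>_eq: "(\<integral>\<^sup>+s\<in>{0..T}. ennreal (\<gamma> s) \<partial>lborel) = G x + G y"
          unfolding \<gamma>_def G_def
          by (subst nn_integral_add[symmetric])
            (auto intro!: nn_integral_cong simp: ennreal_plus g'_nonneg distrib_right)
        show "ennreal (osgood_primitive \<rho> \<delta> (norm (Y (t, x) - Y (t, y))))
          \<le> ennreal (osgood_primitive \<rho> \<delta> (norm (x - y))) + G x + G y"
        proof (cases "G x + G y < \<infinity>")
          case True
          have "osgood_primitive \<rho> \<delta> (norm (Y (t, x) - Y (t, y)))
            \<le> osgood_primitive \<rho> \<delta> (norm (x - y)) + enn2real (\<integral>\<^sup>+s\<in>{0..T}. ennreal (\<gamma> s) \<partial>lborel)"
          proof (rule osgood_two_curves[OF \<rho> \<delta> _ f_m b'_M f_m b'_M Y_int Y_int \<gamma>_m])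
            show "AE s in lborel. s \<in> {0..T} \<longrightarrow> norm (b' (s, Y (s, x)) - b' (s, Y (s, y)))
               \<le> \<gamma> s * \<rho> (norm (Y (s, x) - Y (s, y)))"
              using elim(1) by eventually_elim (simp add: \<gamma>_def \<rho>'_def)
          qed (use T t x elim(2) True \<gamma>_eq g'_nonneg in \<open>auto simp: \<gamma>_def\<close>)
          then have "ennreal (osgood_primitive \<rho> \<delta> (norm (Y (t, x) - Y (t, y))))
            \<le> ennreal (osgood_primitive \<rho> \<delta> (norm (x - y)) + enn2real (G x + G y))"
            unfolding \<gamma>_eq by (rule ennreal_leI)
          also have "\<dots> = ennreal (osgood_primitive \<rho> \<delta> (norm (x - y))) + ennreal (enn2real (G x + G y))"
            using osgood_primitive_nonneg[OF \<rho> \<delta>] by (intro ennreal_plus) auto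
          also have "ennreal (enn2real (G x + G y)) = G x + G y"
            using True by (intro ennreal_enn2real) simp
          finally show ?thesis by (simp add: add.assoc)
        next
          case False
          then have "G x + G y = top" by (simp only: infinity_ennreal_def less_top[symmetric] not_not)
          then show ?thesis by (simp only: add.assoc) simp
        qed
      qed
    qed
  qed
  have "osgood_flow T M \<rho> Y G"
    unfolding osgood_flow_def using Y_m G_m Y_0 Y_Lip pair by blast
  then show thesis using XY G_bound by (rule that)
qed

section \<open>Mollified flows\<close>

lemma nn_integral_lborel_shift:
  fixes f :: "'a::euclidean_space \<Rightarrow> ennreal"
  assumes [measurable]: "f \<in> borel_measurable borel"
  shows "(\<integral>\<^sup>+y. f (y - x) \<partial>lborel) = (\<integral>\<^sup>+y. f y \<partial>lborel)"
proof -
  have "(\<integral>\<^sup>+y. f y \<partial>lborel) = (\<integral>\<^sup>+y. f y \<partial>distr lborel borel ((+) (- x)))"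
    by (simp add: lborel_distr_plus)
  also have "\<dots> = (\<integral>\<^sup>+y. f (- x + y) \<partial>lborel)" by (subst nn_integral_distr) auto
  finally show ?thesis by (simp add: algebra_simps)
qed

text \<open>
  A nonnegative \<open>K\<close>-Lipschitz kernel of mass \<open>1\<close> vanishing outside the ball of radius \<open>r\<close>. The mass
  is required of all translates, and both as a function of \<open>y\<close> and of \<open>x\<close>, in the form in which it is used.
\<close>

definition mollifier :: "real \<Rightarrow> real \<Rightarrow> ('a::euclidean_space \<Rightarrow> real) \<Rightarrow> bool" where
  "mollifier r K k \<longleftrightarrow> k \<in> borel_measurable borel \<and> (\<forall>z. 0 \<le> k z) \<and> (\<forall>z. r \<le> norm z \<longrightarrow> k z = 0) \<and>
     (\<forall>z w. \<bar>k z - k w\<bar> \<le> K * norm (z - w)) \<and>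
     (\<forall>x. (\<integral>\<^sup>+y. ennreal (k (y - x)) \<partial>lborel) = 1) \<and> (\<forall>y. (\<integral>\<^sup>+x. ennreal (k (y - x)) \<partial>lborel) = 1)"

lemma mollifier_exists:
  fixes r :: real
  assumes r: "0 < r"
  shows "\<exists>K (k :: 'a::euclidean_space \<Rightarrow> real). mollifier r K k"
proof -
  \<comment> \<open>The kernel is a normalized cone.\<close>
  define q where "q = (\<lambda>z::'a. max 0 (r - norm z))"
  have q_m [measurable]: "q \<in> borel_measurable borel" unfolding q_def by measurable
  have q0: "0 \<le> q z" for z by (simp add: q_def)
  define c where "c = (\<integral>\<^sup>+z. ennreal (q z) \<partial>lborel)"
  have "c \<le> (\<integral>\<^sup>+z. ennreal r * indicator (ball (0::'a) r) z \<partial>lborel)"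
    unfolding c_def using r by (intro nn_integral_mono) (auto simp: q_def indicator_def max_def intro!: ennreal_leI)
  also have "\<dots> = ennreal r * emeasure lborel (ball (0::'a) r)"
    by (rule nn_integral_cmult_indicator) simp
  also have "\<dots> < \<infinity>"
    using emeasure_bounded_finite[of "ball (0::'a) r"] by (simp add: ennreal_mult_less_top)
  finally have c_fin: "c < \<infinity>" .
  have "emeasure lborel (ball (0::'a) (r/2)) \<noteq> 0"
    using content_ball_pos[of "r/2" "0::'a"] r by (auto simp: measure_def)
  then have "0 < ennreal (r/2) * emeasure lborel (ball (0::'a) (r/2))"
    using r by (simp add: ennreal_zero_less_mult_iff zero_less_iff_neq_zero)
  also have "\<dots> = (\<integral>\<^sup>+z. ennreal (r/2) * indicator (ball (0::'a) (r/2)) z \<partial>lborel)"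
    by (rule nn_integral_cmult_indicator[symmetric]) simp
  also have "\<dots> \<le> c"
    unfolding c_def using r by (intro nn_integral_mono) (auto simp: q_def indicator_def max_def intro!: ennreal_leI)
  finally have c_pos: "0 < c" .
  define c' where "c' = enn2real c"
  have c': "c = ennreal c'" "0 < c'"
    using c_fin c_pos by (auto simp: c'_def ennreal_enn2real_if enn2real_positive_iff)
  define k where "k = (\<lambda>z. q z / c')"
  have k_m [measurable]: "k \<in> borel_measurable borel" unfolding k_def by measurable
  have int_k: "(\<integral>\<^sup>+y. ennreal (k y) \<partial>lborel) = 1"
  proof -
    have "(\<integral>\<^sup>+y. ennreal (k y) \<partial>lborel) = (\<integral>\<^sup>+y. ennreal (q y) / ennreal c' \<partial>lborel)"
      unfolding k_def using c' q0 by (intro nn_integral_cong) (simp add: divide_ennreal)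
    also have "\<dots> = c / ennreal c'" unfolding c_def by (rule nn_integral_divide) simp
    also have "\<dots> = 1" using c' by (simp add: divide_ennreal)
    finally show ?thesis .
  qed
  have 1: "(\<integral>\<^sup>+y. ennreal (k (y - x)) \<partial>lborel) = 1" for x
    using nn_integral_lborel_shift[of "\<lambda>y. ennreal (k y)" x] int_k by simp
  have sym: "k (y - x) = k (x - y)" for x y by (simp add: k_def q_def norm_minus_commute)
  have "\<bar>k z - k w\<bar> \<le> 1 / c' * norm (z - w)" for z w
  proof -
    have "\<bar>q z - q w\<bar> \<le> norm (z - w)"
      using norm_triangle_ineq3[of z w] by (auto simp: q_def max_def)
    then show ?thesis using c' by (simp add: k_def divide_right_mono flip: diff_divide_distrib)
  qed
  moreover have "(\<integral>\<^sup>+x. ennreal (k (y - x)) \<partial>lborel) = 1" for y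
    using 1[of y] by (simp add: sym[of y])
  moreover have "0 \<le> k z" "r \<le> norm z \<Longrightarrow> k z = 0" for z
    using c' by (auto simp: k_def q_def)
  ultimately have "mollifier r (1 / c') k"
    using k_m 1 unfolding mollifier_def by blast
  then show ?thesis by blast
qed

lemma osgood_flow_measurable:
  assumes "osgood_flow T M \<rho> Y G"
  shows "Y \<in> borel_measurable (borel \<Otimes>\<^sub>M borel)" "G \<in> borel_measurable borel"
  using assms by (auto simp: osgood_flow_def)

lemma osgood_flow_displacement:
  assumes "osgood_flow T M \<rho> Y G" "0 \<le> M" "t \<in> {0..T}"
  shows "norm (Y (t, x) - x) \<le> M * T"
proof -
  have "\<forall>s\<in>{0..T}. \<forall>t\<in>{0..T}. \<forall>x. norm (Y (t, x) - Y (s, x)) \<le> M * \<bar>t - s\<bar>"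
    using assms(1) unfolding osgood_flow_def by blast
  moreover have "0 \<in> {0..T}" using assms(3) by simp
  ultimately have "norm (Y (t, x) - Y (0, x)) \<le> M * \<bar>t - 0\<bar>" using assms(3) by blast
  also have "\<dots> \<le> M * T" using assms by (intro mult_left_mono) auto
  finally show ?thesis using assms by (simp add: osgood_flow_def)
qed

lemma osgood_flow_norm_le:
  assumes "osgood_flow T M \<rho> Y G" "0 \<le> M" "t \<in> {0..T}"
  shows "norm (Y (t, x)) \<le> norm x + M * T"
  using osgood_flow_displacement[OF assms, of x] norm_triangle_ineq2[of "Y (t, x)" x] by simp

text \<open>Convolution in space, at fixed time, with the reflected kernel \<open>z \<mapsto> k (- z)\<close>.\<close>

definition mollify :: "('a::euclidean_space \<Rightarrow> real) \<Rightarrow> (real \<times> 'a \<Rightarrow> 'a) \<Rightarrow> real \<times> 'a \<Rightarrow> 'a" where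
  "mollify k Y = (\<lambda>(t, x). LINT y|lborel. k (y - x) *\<^sub>R Y (t, y))"

context
  fixes T M r K :: real and \<rho> :: "real \<Rightarrow> real" and k :: "'a::euclidean_space \<Rightarrow> real"
  assumes T: "0 < T" and M: "0 \<le> M" and \<rho>: "osgood_modulus \<rho>" and r: "0 < r"
    and k: "mollifier r K k"
begin

lemma mollifier_measurable [measurable]: "k \<in> borel_measurable borel"
  and mollifier_nonneg: "0 \<le> k z" and mollifier_support: "r \<le> norm z \<Longrightarrow> k z = 0"
  and mollifier_Lipschitz: "\<bar>k z - k w\<bar> \<le> K * norm (z - w)"
  and mollifier_nn_integral: "(\<integral>\<^sup>+y. ennreal (k (y - x)) \<partial>lborel) = 1"
  and mollifier_nn_integral_left: "(\<integral>\<^sup>+x. ennreal (k (y - x)) \<partial>lborel) = 1"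
  using k unfolding mollifier_def by blast+

lemma mollifier_integrable: "integrable lborel (\<lambda>y. k (y - x))"
  by (rule integrableI_nonneg) (auto simp: mollifier_nonneg mollifier_nn_integral)

lemma mollifier_integral: "(LINT y|lborel. k (y - x)) = 1"
  by (subst integral_eq_nn_integral) (auto simp: mollifier_nonneg mollifier_nn_integral)

lemma mollify_measurable:
  assumes [measurable]: "Y \<in> borel_measurable (borel \<Otimes>\<^sub>M borel)"
  shows "mollify k Y \<in> borel_measurable (borel \<Otimes>\<^sub>M borel)"
  unfolding mollify_def by measurable

lemma mollify_integrable:
  assumes flow: "osgood_flow T M \<rho> Y G" and t: "t \<in> {0..T}"
  shows "integrable lborel (\<lambda>y. k (y - x) *\<^sub>R Y (t, y))"
proof (rule Bochner_Integration.integrable_bound)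
  note [measurable] = osgood_flow_measurable[OF flow]
  show "(\<lambda>y. k (y - x) *\<^sub>R Y (t, y)) \<in> borel_measurable lborel" by measurable
  show "integrable lborel (\<lambda>y. k (y - x) * (norm x + r + M * T))"
    by (intro integrable_mult_left mollifier_integrable)
  show "AE y in lborel. norm (k (y - x) *\<^sub>R Y (t, y)) \<le> norm (k (y - x) * (norm x + r + M * T))"
  proof (intro AE_I2)
    fix y
    show "norm (k (y - x) *\<^sub>R Y (t, y)) \<le> norm (k (y - x) * (norm x + r + M * T))"
    proof (cases "r \<le> norm (y - x)")
      case False
      have "norm (Y (t, y)) \<le> norm y + M * T" by (rule osgood_flow_norm_le[OF flow M t])
      also have "\<dots> \<le> norm x + r + M * T" using norm_triangle_ineq2[of y x] False by simp
      finally show ?thesis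
        using r M T by (simp add: abs_mult mollifier_nonneg mult_left_mono)
    qed (simp add: mollifier_support)
  qed
qed

text \<open>The value of the mollification deviates from any \<open>z\<close> by at most the average deviation.\<close>

lemma mollify_deviation:
  assumes flow: "osgood_flow T M \<rho> Y G" and t: "t \<in> {0..T}"
  shows "ennreal (norm (z - mollify k Y (t, x))) \<le> (\<integral>\<^sup>+y. ennreal (k (y - x)) * ennreal (norm (z - Y (t, y))) \<partial>lborel)"
proof -
  note [measurable] = osgood_flow_measurable[OF flow]
  have iz: "integrable lborel (\<lambda>y. k (y - x) *\<^sub>R z)" by (intro integrable_scaleR_left mollifier_integrable)
  have "(LINT y|lborel. k (y - x) *\<^sub>R z) = z"
    by (subst integral_scaleR_left) (auto simp: mollifier_integral mollifier_integrable)
  then have "z - mollify k Y (t, x) = (LINT y|lborel. k (y - x) *\<^sub>R z) - (LINT y|lborel. k (y - x) *\<^sub>R Y (t, y))"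
    unfolding mollify_def by simp
  also have "\<dots> = (LINT y|lborel. k (y - x) *\<^sub>R (z - Y (t, y)))"
    using iz mollify_integrable[OF flow t, of x]
    by (subst Bochner_Integration.integral_diff[symmetric]) (auto simp: scaleR_diff_right)
  also have "ennreal (norm \<dots>) \<le> (\<integral>\<^sup>+y. ennreal (norm (k (y - x) *\<^sub>R (z - Y (t, y)))) \<partial>lborel)"
    using iz mollify_integrable[OF flow t, of x]
    by (intro integral_norm_bound_ennreal) (auto simp: scaleR_diff_right)
  also have "\<dots> = (\<integral>\<^sup>+y. ennreal (k (y - x)) * ennreal (norm (z - Y (t, y))) \<partial>lborel)"
    by (intro nn_integral_cong) (simp add: mollifier_nonneg ennreal_mult)
  finally show ?thesis .
qed

lemma mollify_norm_le:
  assumes flow: "osgood_flow T M \<rho> Y G" and t: "t \<in> {0..T}"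
  shows "norm (mollify k Y (t, x)) \<le> norm x + r + M * T"
proof -
  have "ennreal (norm (0 - mollify k Y (t, x))) \<le> (\<integral>\<^sup>+y. ennreal (k (y - x)) * ennreal (norm (0 - Y (t, y))) \<partial>lborel)"
    by (rule mollify_deviation[OF flow t])
  also have "\<dots> \<le> (\<integral>\<^sup>+y. ennreal (k (y - x)) * ennreal (norm x + r + M * T) \<partial>lborel)"
  proof (intro nn_integral_mono)
    fix y
    show "ennreal (k (y - x)) * ennreal (norm (0 - Y (t, y))) \<le> ennreal (k (y - x)) * ennreal (norm x + r + M * T)"
    proof (cases "r \<le> norm (y - x)")
      case False
      have "norm (Y (t, y)) \<le> norm y + M * T" by (rule osgood_flow_norm_le[OF flow M t])
      also have "\<dots> \<le> norm x + r + M * T" using norm_triangle_ineq2[of y x] False by simp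
      finally show ?thesis by (intro mult_left_mono ennreal_leI) auto
    qed (simp add: mollifier_support)
  qed
  also have "\<dots> = ennreal (norm x + r + M * T)"
    by (subst nn_integral_multc) (auto simp: mollifier_nn_integral)
  finally have "ennreal (norm (mollify k Y (t, x))) \<le> ennreal (norm x + r + M * T)" by simp
  moreover have "0 \<le> norm x + r + M * T" using r M T by simp
  ultimately show ?thesis by (simp only: ennreal_le_iff)
qed

lemma mollify_time_Lipschitz:
  assumes flow: "osgood_flow T M \<rho> Y G" and st: "s \<in> {0..T}" "t \<in> {0..T}"
  shows "norm (mollify k Y (t, x) - mollify k Y (s, x)) \<le> M * \<bar>t - s\<bar>"
proof -
  have "mollify k Y (t, x) - mollify k Y (s, x) = (LINT y|lborel. k (y - x) *\<^sub>R (Y (t, y) - Y (s, y)))"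
    unfolding mollify_def using mollify_integrable[OF flow] st
    by (simp add: scaleR_diff_right)
  also have "norm \<dots> \<le> (LINT y|lborel. k (y - x) * (M * \<bar>t - s\<bar>))"
  proof (rule Bochner_Integration.integral_norm_bound_integral)
    show "integrable lborel (\<lambda>y. k (y - x) *\<^sub>R (Y (t, y) - Y (s, y)))"
      unfolding scaleR_diff_right using mollify_integrable[OF flow] st by auto
    show "integrable lborel (\<lambda>y. k (y - x) * (M * \<bar>t - s\<bar>))" by (intro integrable_mult_left mollifier_integrable)
    show "norm (k (y - x) *\<^sub>R (Y (t, y) - Y (s, y))) \<le> k (y - x) * (M * \<bar>t - s\<bar>)" for y
      using flow st by (auto simp: osgood_flow_def mollifier_nonneg intro!: mult_left_mono)
  qed
  also have "\<dots> = M * \<bar>t - s\<bar>" by (simp add: mollifier_integral)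
  finally show ?thesis .
qed

lemma mollify_space_Lipschitz:
  assumes flow: "osgood_flow T M \<rho> Y G" and t: "t \<in> {0..T}" and x: "norm x \<le> R" "norm x' \<le> R"
  shows "norm (mollify k Y (t, x) - mollify k Y (t, x'))
    \<le> K * (R + r + M * T) * measure lborel (ball (0::'a) (R + r)) * norm (x - x')"
proof -
  let ?B = "ball (0::'a) (R + r)"
  have K: "0 \<le> K"
  proof -
    obtain u :: 'a where "norm u = 1" using vector_choose_size[of 1] by auto
    then show ?thesis using mollifier_Lipschitz[of u 0] by simp
  qed
  have R: "0 \<le> R" using x(1) norm_ge_zero order_trans by blast
  have "mollify k Y (t, x) - mollify k Y (t, x') = (LINT y|lborel. (k (y - x) - k (y - x')) *\<^sub>R Y (t, y))"
    unfolding mollify_def using mollify_integrable[OF flow t] by (simp add: scaleR_diff_left)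
  also have "norm \<dots> \<le> (LINT y|lborel. (K * norm (x - x') * (R + r + M * T)) * indicator ?B y)"
  proof (rule Bochner_Integration.integral_norm_bound_integral)
    show "integrable lborel (\<lambda>y. (k (y - x) - k (y - x')) *\<^sub>R Y (t, y))"
      unfolding scaleR_diff_left using mollify_integrable[OF flow t] by auto
    show "integrable lborel (\<lambda>y. (K * norm (x - x') * (R + r + M * T)) * indicator ?B y)"
      using emeasure_bounded_finite[of ?B] by (intro integrable_mult_right) simp
    fix y
    show "norm ((k (y - x) - k (y - x')) *\<^sub>R Y (t, y)) \<le> (K * norm (x - x') * (R + r + M * T)) * indicator ?B y"
    proof (cases "y \<in> ?B")
      case True
      have "norm (Y (t, y)) \<le> norm y + M * T" by (rule osgood_flow_norm_le[OF flow M t])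
      also have "\<dots> \<le> R + r + M * T" using True by simp
      finally have 1: "norm (Y (t, y)) \<le> R + r + M * T" .
      have 2: "\<bar>k (y - x) - k (y - x')\<bar> \<le> K * norm (x - x')"
        using mollifier_Lipschitz[of "y - x" "y - x'"] by (simp add: norm_minus_commute)
      have "\<bar>k (y - x) - k (y - x')\<bar> * norm (Y (t, y)) \<le> K * norm (x - x') * (R + r + M * T)"
        using K by (intro mult_mono 1 2) auto
      then show ?thesis using True by simp
    next
      case False
      then have "r \<le> norm (y - x)" "r \<le> norm (y - x')"
        using x norm_triangle_ineq2[of y x] norm_triangle_ineq2[of y x'] by auto
      then show ?thesis using False by (simp add: mollifier_support)
    qed
  qed
  also have "\<dots> = K * (R + r + M * T) * measure lborel ?B * norm (x - x')" by simp
  finally show ?thesis .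
qed

text \<open>
  The mollified flow is close to the flow in \<open>L\<^sup>1\<close> of a ball, with an error depending on the flow only
  through the integral of \<open>G\<close>. If that integral stays bounded, then as \<open>r \<rightarrow> 0\<close> the bound tends to \<open>\<eta>\<close> times
  the volume of the ball, because \<open>osgood_primitive \<rho> r \<eta>\<close> tends to infinity.
\<close>

lemma mollify_error:
  fixes R \<eta> :: real
  defines "a \<equiv> ennreal ((r + 2 * M * T) / osgood_primitive \<rho> r \<eta>)"
  assumes flow: "osgood_flow T M \<rho> Y G" and t: "t \<in> {0..T}"
    and \<eta>: "0 < \<eta>" "0 < osgood_primitive \<rho> r \<eta>"
  shows "(\<integral>\<^sup>+x\<in>ball 0 R. ennreal (norm (Y (t, x) - mollify k Y (t, x))) \<partial>lborel)
    \<le> (ennreal \<eta> + a) * emeasure lborel (ball (0::'a) R) + 2 * a * (\<integral>\<^sup>+x\<in>ball 0 (R + r). G x \<partial>lborel)"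
proof -
  note [measurable] = osgood_flow_measurable[OF flow]
  have [measurable]: "ball c q \<in> sets borel" for c :: 'a and q by simp
  let ?B = "ball (0::'a) R" and ?B' = "ball (0::'a) (R + r)"
  let ?\<psi> = "osgood_primitive \<rho> r"
  define W where "W = r + 2 * M * T"
  have W: "0 \<le> W" using r M T by (simp add: W_def)
  have pair: "AE x in lborel. AE y in lborel. ennreal (k (y - x)) * ennreal (norm (Y (t, x) - Y (t, y)))
      \<le> ennreal (k (y - x)) * (ennreal \<eta> + a * (1 + G x + G y))"
  proof -
    have "AE x in lborel. AE y in lborel. \<forall>t\<in>{0..T}. \<forall>\<delta>>0.
       ennreal (osgood_primitive \<rho> \<delta> (norm (Y (t, x) - Y (t, y))))
         \<le> ennreal (osgood_primitive \<rho> \<delta> (norm (x - y))) + G x + G y"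
      using flow by (simp add: osgood_flow_def)
    then show ?thesis
    proof (rule eventually_mono, elim eventually_mono)
      fix x y
      assume *: "\<forall>t\<in>{0..T}. \<forall>\<delta>>0. ennreal (osgood_primitive \<rho> \<delta> (norm (Y (t, x) - Y (t, y))))
         \<le> ennreal (osgood_primitive \<rho> \<delta> (norm (x - y))) + G x + G y"
      let ?d = "norm (Y (t, x) - Y (t, y))"
      show "ennreal (k (y - x)) * ennreal ?d \<le> ennreal (k (y - x)) * (ennreal \<eta> + a * (1 + G x + G y))"
      proof (cases "r \<le> norm (y - x)")
        case False
        \<comment> \<open>A distance above \<open>\<eta>\<close> is still at most \<open>W\<close>, and \<open>1 \<le> (1 + G x + G y) / \<psi>(\<eta>)\<close> by the Osgood estimate.\<close>
        have "ennreal ?d \<le> ennreal \<eta> + a * (1 + G x + G y)"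
        proof (cases "?d \<le> \<eta>")
          case True
          then have "ennreal ?d \<le> ennreal \<eta>" by (rule ennreal_leI)
          then show ?thesis by (simp add: add_increasing2)
        next
          case far: False
          have "Y (t, x) - Y (t, y) = (Y (t, x) - x) + (x - y) - (Y (t, y) - y)" by simp
          also have "norm \<dots> \<le> norm (Y (t, x) - x) + norm (x - y) + norm (Y (t, y) - y)"
            by (metis (no_types) norm_triangle_ineq norm_triangle_ineq4 add_mono_thms_linordered_semiring(3) order_trans)
          also have "\<dots> \<le> M * T + r + M * T"
            using False osgood_flow_displacement[OF flow M t] by (intro add_mono) (auto simp: norm_minus_commute)
          finally have dW: "?d \<le> W" by (simp add: W_def)
          have "?\<psi> \<eta> \<le> ?\<psi> ?d" using far \<eta> by (intro osgood_primitive_mono[OF \<rho> r]) auto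
          then have "ennreal (?\<psi> \<eta>) \<le> ennreal (?\<psi> ?d)" by (rule ennreal_leI)
          also have "\<dots> \<le> ennreal (?\<psi> (norm (x - y))) + G x + G y" using * t r by blast
          also have "ennreal (?\<psi> (norm (x - y))) \<le> 1"
          proof -
            have "?\<psi> (norm (x - y)) \<le> norm (x - y) / r" by (rule osgood_primitive_le[OF \<rho> r]) simp
            also have "\<dots> \<le> 1" using False r by (simp add: norm_minus_commute)
            finally show ?thesis by simp
          qed
          finally have 1: "ennreal (?\<psi> \<eta>) \<le> 1 + G x + G y" by (simp add: add_mono)
          have "ennreal ?d \<le> ennreal W" using dW by (rule ennreal_leI)
          also have "\<dots> = a * ennreal (?\<psi> \<eta>)"
            unfolding a_def W_def[symmetric] using \<eta> W by (simp flip: ennreal_mult)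
          also have "\<dots> \<le> a * (1 + G x + G y)" by (intro mult_left_mono 1) auto
          finally show ?thesis by (simp add: add_increasing)
        qed
        then show ?thesis by (intro mult_left_mono) auto
      qed (simp add: mollifier_support)
    qed
  qed
  have "(\<integral>\<^sup>+x\<in>?B. ennreal (norm (Y (t, x) - mollify k Y (t, x))) \<partial>lborel)
      \<le> (\<integral>\<^sup>+x\<in>?B. (\<integral>\<^sup>+y. ennreal (k (y - x)) * ennreal (norm (Y (t, x) - Y (t, y))) \<partial>lborel) \<partial>lborel)"
    by (intro nn_integral_mono mult_right_mono mollify_deviation[OF flow t]) auto
  also have "\<dots> \<le> (\<integral>\<^sup>+x\<in>?B. (\<integral>\<^sup>+y. ennreal (k (y - x)) * (ennreal \<eta> + a * (1 + G x + G y)) \<partial>lborel) \<partial>lborel)"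
    using pair by (intro nn_integral_mono_AE, eventually_elim) (intro mult_right_mono nn_integral_mono_AE, auto)
  also have "\<dots> = (\<integral>\<^sup>+x. (ennreal \<eta> + a) * indicator ?B x + a * (G x * indicator ?B x)
      + a * (\<integral>\<^sup>+y. ennreal (k (y - x)) * G y * indicator ?B x \<partial>lborel) \<partial>lborel)"
  proof (intro nn_integral_cong)
    fix x
    have "(\<integral>\<^sup>+y. ennreal (k (y - x)) * (ennreal \<eta> + a * (1 + G x + G y)) \<partial>lborel)
      = (\<integral>\<^sup>+y. ennreal (k (y - x)) * (ennreal \<eta> + a + a * G x) + a * (ennreal (k (y - x)) * G y) \<partial>lborel)"
      by (intro nn_integral_cong) (simp add: algebra_simps)
    also have "\<dots> = (ennreal \<eta> + a + a * G x) + a * (\<integral>\<^sup>+y. ennreal (k (y - x)) * G y \<partial>lborel)"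
      by (subst nn_integral_add) (auto simp: nn_integral_multc nn_integral_cmult mollifier_nn_integral)
    finally show "(\<integral>\<^sup>+y. ennreal (k (y - x)) * (ennreal \<eta> + a * (1 + G x + G y)) \<partial>lborel) * indicator ?B x
      = (ennreal \<eta> + a) * indicator ?B x + a * (G x * indicator ?B x)
      + a * (\<integral>\<^sup>+y. ennreal (k (y - x)) * G y * indicator ?B x \<partial>lborel)"
      by (simp add: nn_integral_multc indicator_def)
  qed
  also have "\<dots> = (ennreal \<eta> + a) * emeasure lborel ?B + a * (\<integral>\<^sup>+x\<in>?B. G x \<partial>lborel)
      + a * (\<integral>\<^sup>+x. \<integral>\<^sup>+y. ennreal (k (y - x)) * G y * indicator ?B x \<partial>lborel \<partial>lborel)"
    by (simp add: nn_integral_add nn_integral_cmult)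
  also have "(\<integral>\<^sup>+x. \<integral>\<^sup>+y. ennreal (k (y - x)) * G y * indicator ?B x \<partial>lborel \<partial>lborel)
      = (\<integral>\<^sup>+y. \<integral>\<^sup>+x. ennreal (k (y - x)) * G y * indicator ?B x \<partial>lborel \<partial>lborel)"
    by (rule lborel_pair.Fubini'[symmetric]) measurable
  also have "\<dots> \<le> (\<integral>\<^sup>+y. \<integral>\<^sup>+x. ennreal (k (y - x)) * (G y * indicator ?B' y) \<partial>lborel \<partial>lborel)"
  proof (intro nn_integral_mono)
    fix y x
    show "ennreal (k (y - x)) * G y * indicator ?B x \<le> ennreal (k (y - x)) * (G y * indicator ?B' y)"
    proof (cases "x \<in> ?B \<and> y \<notin> ?B'")
      case True
      then have "r \<le> norm (y - x)" using norm_triangle_ineq2[of y x] by auto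
      then show ?thesis by (simp add: mollifier_support)
    qed (auto simp: indicator_def mult.assoc)
  qed
  also have "\<dots> = (\<integral>\<^sup>+x\<in>?B'. G x \<partial>lborel)"
    by (intro nn_integral_cong) (simp add: nn_integral_multc mollifier_nn_integral_left)
  also have "(\<integral>\<^sup>+x\<in>?B. G x \<partial>lborel) \<le> (\<integral>\<^sup>+x\<in>?B'. G x \<partial>lborel)"
    using r by (intro nn_integral_mono) (auto simp: indicator_def)
  finally show ?thesis by (simp add: add_mono mult_left_mono mult_2 distrib_right add.assoc)
qed

end

section \<open>Subsequences converging almost everywhere\<close>

text \<open>A sequence of kernels \<open>k m\<close> of radius \<open>1 / (m + 1)\<close> is fixed; their Lipschitz constants may blow up.\<close>

context
  fixes T M :: real and \<rho> :: "real \<Rightarrow> real" and k :: "nat \<Rightarrow> 'a::euclidean_space \<Rightarrow> real" and K :: "nat \<Rightarrow> real"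
  assumes T: "0 < T" and M: "0 \<le> M" and \<rho>: "osgood_modulus \<rho>"
    and k: "\<And>m. mollifier (1 / real (Suc m)) (K m) (k m)"
begin

lemma inverse_Suc_pos: "0 < 1 / real (Suc m)"
  by simp

text \<open>
  Pointwise convergence on a countable dense set of space-time, for all kernels at once, spreads to
  all points by equicontinuity.
\<close>

lemma mollified_subsequence:
  fixes Y :: "nat \<Rightarrow> real \<times> 'a \<Rightarrow> 'a"
  assumes flow: "\<And>n. osgood_flow T M \<rho> (Y n) (G n)"
  obtains s where "strict_mono (s :: nat \<Rightarrow> nat)"
    "\<And>m t x. t \<in> {0..T} \<Longrightarrow> convergent (\<lambda>n. mollify (k m) (Y (s n)) (t, x))"
proof -
  note moll = T M \<rho> inverse_Suc_pos k flow
  obtain D :: "(real \<times> 'a) set" where D: "countable D" "D \<subseteq> {0..T} \<times> UNIV" "{0..T} \<times> UNIV \<subseteq> closure D"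
    by (rule separable)
  \<comment> \<open>The weight makes the mollified flows bounded by \<open>1\<close> on all of \<open>D\<close>.\<close>
  define f where "f = (\<lambda>n (p, m). (1 / (norm (snd p) + 1 + M * T)) *\<^sub>R mollify (k m) (Y n) p)"
  have pos: "0 < norm (x::'a) + 1 + M * T" for x
    using T M by (intro add_nonneg_pos add_pos_nonneg) auto
  have D_count: "countable (D \<times> (UNIV :: nat set))" using D(1) by auto
  have f_le: "norm (f n q) \<le> 1" if "q \<in> D \<times> (UNIV :: nat set)" for n q
  proof -
    obtain t x m where q: "q = ((t, x), m)" by (metis prod.exhaust)
    have t: "t \<in> {0..T}" using that D(2) q by auto
    have "norm (mollify (k m) (Y n) (t, x)) \<le> norm x + 1 / real (Suc m) + M * T"
      by (rule mollify_norm_le[OF moll t])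
    also have "\<dots> \<le> norm x + 1 + M * T" by simp
    finally show ?thesis using pos[of x] by (simp add: f_def q divide_le_eq)
  qed
  have "\<exists>s. strict_mono (s :: nat \<Rightarrow> nat) \<and> (\<forall>q \<in> D \<times> (UNIV :: nat set). \<exists>l. (\<lambda>n. f (s n) q) \<longlonglongrightarrow> l)"
  proof (rule function_convergent_subsequence[where f = f and M = 1, OF D_count f_le])
    fix s :: "nat \<Rightarrow> nat"
    assume "strict_mono s" and *: "\<And>q. q \<in> D \<times> (UNIV :: nat set) \<Longrightarrow> \<exists>l. (\<lambda>n. f (s n) q) \<longlonglongrightarrow> l"
    then show ?thesis by (intro exI[of _ s] conjI ballI *)
  qed
  then obtain s where s: "strict_mono (s :: nat \<Rightarrow> nat)"
    and lim: "\<forall>q \<in> D \<times> (UNIV :: nat set). \<exists>l. (\<lambda>n. f (s n) q) \<longlonglongrightarrow> l" by blast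
  have conv_D: "convergent (\<lambda>n. mollify (k m) (Y (s n)) p)" if "p \<in> D" for p m
  proof -
    have "(p, m) \<in> D \<times> UNIV" using that by simp
    then obtain l where l: "(\<lambda>n. f (s n) (p, m)) \<longlonglongrightarrow> l" using lim by blast
    have eq: "(norm (snd p) + 1 + M * T) *\<^sub>R f n (p, m) = mollify (k m) (Y n) p" for n
      using pos[of "snd p"] by (simp add: f_def)
    show ?thesis
      using convergentI[OF tendsto_scaleR[OF tendsto_const[of "norm (snd p) + 1 + M * T"] l]] unfolding eq .
  qed
  show thesis
  proof (rule that[OF s])
    fix m and t :: real and x :: 'a assume t: "t \<in> {0..T}"
    define c where "c = K m * (norm x + 1 + 1 / real (Suc m) + M * T) * measure lborel (ball (0::'a) (norm x + 1 + 1 / real (Suc m)))"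
    have "Cauchy (\<lambda>n. mollify (k m) (Y (s n)) (t, x))"
    proof (rule metric_CauchyI)
      fix e :: real assume e: "0 < e"
      define d where "d = min 1 (e / (3 * (M + \<bar>c\<bar> + 1)))"
      have d: "0 < d" using e M by (simp add: d_def)
      have "(t, x) \<in> closure D" using t D(3) by auto
      then obtain p where p: "p \<in> D" "dist p (t, x) < d" using d unfolding closure_approachable by blast
      obtain t' x' where p_eq: "p = (t', x')" by (cases p)
      have t': "t' \<in> {0..T}" using p(1) D(2) p_eq by auto
      have dt: "\<bar>t - t'\<bar> \<le> dist p (t, x)"
        using dist_fst_le[of p "(t, x)"] by (simp add: p_eq dist_real_def abs_minus_commute)
      have dx: "norm (x - x') \<le> dist p (t, x)"
        using dist_snd_le[of p "(t, x)"] by (simp add: p_eq dist_norm norm_minus_commute)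
      have x': "norm x' \<le> norm x + 1"
        using norm_triangle_ineq2[of x' x] dx p(2) by (simp add: d_def norm_minus_commute)
      have near: "dist (mollify (k m) (Y n) (t, x)) (mollify (k m) (Y n) p) < e / 3" for n
      proof -
        have "dist (mollify (k m) (Y n) (t, x)) (mollify (k m) (Y n) p)
          \<le> dist (mollify (k m) (Y n) (t, x)) (mollify (k m) (Y n) (t', x)) + dist (mollify (k m) (Y n) (t', x)) (mollify (k m) (Y n) p)"
          by (rule dist_triangle)
        also have "\<dots> \<le> M * \<bar>t - t'\<bar> + c * norm (x - x')"
          unfolding p_eq c_def dist_norm using x'
          by (intro add_mono mollify_time_Lipschitz[OF moll t' t] mollify_space_Lipschitz[OF moll t']) auto
        also have "\<dots> \<le> M * dist p (t, x) + \<bar>c\<bar> * dist p (t, x)"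
          using M dt dx by (intro add_mono mult_left_mono mult_mono) auto
        also have "\<dots> = (M + \<bar>c\<bar>) * dist p (t, x)" by (simp add: distrib_right)
        also have "\<dots> \<le> (M + \<bar>c\<bar> + 1) * dist p (t, x)" by (intro mult_right_mono) auto
        also have "\<dots> < (M + \<bar>c\<bar> + 1) * d" using p(2) M by (intro mult_strict_left_mono) auto
        also have "\<dots> \<le> (M + \<bar>c\<bar> + 1) * (e / (3 * (M + \<bar>c\<bar> + 1)))" using M by (intro mult_left_mono) (auto simp: d_def)
        also have "\<dots> = e / 3" using M by (simp add: field_simps)
        finally show ?thesis .
      qed
      have "Cauchy (\<lambda>n. mollify (k m) (Y (s n)) p)" by (rule convergent_Cauchy[OF conv_D[OF p(1)]])
      then obtain N where N: "\<And>i j. N \<le> i \<Longrightarrow> N \<le> j \<Longrightarrow>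
          dist (mollify (k m) (Y (s i)) p) (mollify (k m) (Y (s j)) p) < e / 3"
        using e unfolding Cauchy_def by (metis zero_less_divide_iff zero_less_numeral)
      show "\<exists>N. \<forall>i\<ge>N. \<forall>j\<ge>N. dist (mollify (k m) (Y (s i)) (t, x)) (mollify (k m) (Y (s j)) (t, x)) < e"
      proof (intro exI[of _ N] allI impI)
        fix i j assume "N \<le> i" "N \<le> j"
        from N[OF this] near[of "s i"] near[of "s j"]
        show "dist (mollify (k m) (Y (s i)) (t, x)) (mollify (k m) (Y (s j)) (t, x)) < e"
          using dist_triangle[of "mollify (k m) (Y (s i)) (t, x)" "mollify (k m) (Y (s j)) (t, x)" "mollify (k m) (Y (s i)) p"]
            dist_triangle[of "mollify (k m) (Y (s i)) p" "mollify (k m) (Y (s j)) (t, x)" "mollify (k m) (Y (s j)) p"]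
          by (simp add: dist_commute)
      qed
    qed
    then show "convergent (\<lambda>n. mollify (k m) (Y (s n)) (t, x))" by (rule Cauchy_convergent)
  qed
qed

text \<open>The choice of the kernel depends on the flow only through the bound \<open>C\<close> on the integral of \<open>G\<close>.\<close>

lemma mollify_uniformly_close:
  fixes C e R :: real
  assumes e: "0 < e"
  obtains m where "\<And>Y G. osgood_flow T M \<rho> Y G \<Longrightarrow> (\<integral>\<^sup>+x\<in>ball 0 (R + 1). G x \<partial>lborel) \<le> ennreal C \<Longrightarrow>
    (\<integral>\<^sup>+p\<in>{0..T} \<times> ball 0 R. ennreal (norm (Y p - mollify (k m) Y p)) \<partial>lborel) \<le> ennreal e"
proof -
  define V where "V = measure lborel (ball (0::'a) R)"
  have V: "emeasure lborel (ball (0::'a) R) = ennreal V"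
    using emeasure_lborel_ball_finite[of "0::'a" R] unfolding V_def
    by (intro emeasure_eq_ennreal_measure) (simp add: less_top)
  have V0: "0 \<le> V" by (simp add: V_def)
  define C' where "C' = \<bar>C\<bar>"
  have C': "0 \<le> C'" by (simp add: C'_def)
  \<comment> \<open>\<open>\<eta>\<close> makes the first part of the error at most \<open>e/2\<close>; a small radius then handles the second part.\<close>
  define \<eta> where "\<eta> = e / (2 * T * (V + 1))"
  have \<eta>: "0 < \<eta>" using e T V0 by (simp add: \<eta>_def)
  have \<eta>V: "T * (\<eta> * V) \<le> e / 2"
  proof -
    have "T * (\<eta> * V) \<le> T * (\<eta> * (V + 1))" using T \<eta> by (intro mult_left_mono) auto
    also have "\<dots> = e / 2" using T V0 by (simp add: \<eta>_def divide_simps)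
    finally show ?thesis .
  qed
  define S where "S = T * (1 + 2 * M * T) * (V + 2 * C')"
  have S: "0 \<le> S" using T M V0 C' by (simp add: S_def)
  obtain m where m: "2 * S / e + 1 \<le> osgood_primitive \<rho> (1 / real (Suc m)) \<eta>"
    using osgood_primitive_at_top[OF \<rho> \<eta>] by blast
  define r where "r = 1 / real (Suc m)"
  have r: "0 < r" "r \<le> 1" by (auto simp: r_def)
  define p where "p = osgood_primitive \<rho> r \<eta>"
  have p: "0 < p" "2 * S / e \<le> p"
  proof -
    have "0 \<le> 2 * S / e" using S e by simp
    with m show "0 < p" "2 * S / e \<le> p" unfolding p_def r_def by linarith+
  qed
  define a where "a = (r + 2 * M * T) / p"
  have a0: "0 \<le> a" using r M T p by (simp add: a_def)
  have "T * (a * (V + 2 * C')) \<le> S / p"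
  proof -
    have "T * (a * (V + 2 * C')) = (r + 2 * M * T) * (T * (V + 2 * C')) / p" by (simp add: a_def)
    also have "\<dots> \<le> (1 + 2 * M * T) * (T * (V + 2 * C')) / p"
      using r T M V0 C' p by (intro divide_right_mono mult_right_mono) auto
    also have "\<dots> = S / p" by (simp add: S_def algebra_simps)
    finally show ?thesis .
  qed
  also have "\<dots> \<le> e / 2" using p e by (simp add: divide_simps mult.commute)
  finally have aS: "T * (a * (V + 2 * C')) \<le> e / 2" .
  show thesis
  proof (rule that[of m])
    fix Y :: "real \<times> 'a \<Rightarrow> 'a" and G
    assume flow: "osgood_flow T M \<rho> Y G" and G: "(\<integral>\<^sup>+x\<in>ball 0 (R + 1). G x \<partial>lborel) \<le> ennreal C"
    note [measurable] = osgood_flow_measurable[OF flow] mollify_measurable[OF T M \<rho> inverse_Suc_pos k]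
    have [measurable]: "ball c q \<in> sets borel" for c :: 'a and q by simp
    have kr: "mollifier r (K m) (k m)" using k by (simp add: r_def)
    have slice: "(\<integral>\<^sup>+x\<in>ball 0 R. ennreal (norm (Y (t, x) - mollify (k m) Y (t, x))) \<partial>lborel)
        \<le> ennreal ((\<eta> + a) * V + 2 * a * C')" if "t \<in> {0..T}" for t
    proof -
      have "(\<integral>\<^sup>+x\<in>ball 0 R. ennreal (norm (Y (t, x) - mollify (k m) Y (t, x))) \<partial>lborel)
        \<le> (ennreal \<eta> + ennreal a) * ennreal V + 2 * ennreal a * (\<integral>\<^sup>+x\<in>ball 0 (R + r). G x \<partial>lborel)"
        using mollify_error[OF T M \<rho> r(1) kr flow that \<eta>, of R] p(1) by (simp add: V a_def p_def)
      also have "(\<integral>\<^sup>+x\<in>ball 0 (R + r). G x \<partial>lborel) \<le> (\<integral>\<^sup>+x\<in>ball 0 (R + 1). G x \<partial>lborel)"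
        using r by (intro nn_integral_mono) (auto simp: indicator_def)
      also have "\<dots> \<le> ennreal C" by (rule G)
      also have "\<dots> \<le> ennreal C'" by (intro ennreal_leI) (simp add: C'_def)
      also have "(ennreal \<eta> + ennreal a) * ennreal V + 2 * ennreal a * ennreal C' = ennreal ((\<eta> + a) * V + 2 * a * C')"
        using \<eta> a0 V0 C' by (simp add: ennreal_plus ennreal_mult flip: ennreal_numeral)
      finally show ?thesis by (simp add: add_mono mult_left_mono)
    qed
    have meas: "(\<lambda>p. ennreal (norm (Y p - mollify (k m) Y p)) * indicator ({0..T} \<times> ball 0 R) p)
        \<in> borel_measurable (lborel \<Otimes>\<^sub>M lborel)"
      unfolding indicator_times by measurable
    have "(\<integral>\<^sup>+p\<in>{0..T} \<times> ball 0 R. ennreal (norm (Y p - mollify (k m) Y p)) \<partial>lborel)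
      = (\<integral>\<^sup>+t. \<integral>\<^sup>+x. ennreal (norm (Y (t, x) - mollify (k m) Y (t, x))) * indicator ({0..T} \<times> ball 0 R) (t, x) \<partial>lborel \<partial>lborel)"
      using lborel.nn_integral_fst[OF meas, symmetric] unfolding lborel_prod .
    also have "\<dots> \<le> (\<integral>\<^sup>+t. ennreal ((\<eta> + a) * V + 2 * a * C') * indicator {0..T} t \<partial>lborel)"
    proof (intro nn_integral_mono)
      fix t
      show "(\<integral>\<^sup>+x. ennreal (norm (Y (t, x) - mollify (k m) Y (t, x))) * indicator ({0..T} \<times> ball 0 R) (t, x) \<partial>lborel)
        \<le> ennreal ((\<eta> + a) * V + 2 * a * C') * indicator {0..T} t"
        using slice[of t] by (cases "t \<in> {0..T}") (simp_all add: indicator_times)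
    qed
    also have "\<dots> = ennreal ((\<eta> + a) * V + 2 * a * C') * emeasure lborel {0..T}"
      by (rule nn_integral_cmult_indicator) simp
    also have "\<dots> = ennreal (T * (\<eta> * V) + T * (a * (V + 2 * C')))"
    proof -
      have "((\<eta> + a) * V + 2 * a * C') * T = T * (\<eta> * V) + T * (a * (V + 2 * C'))" by (simp add: algebra_simps)
      moreover have "ennreal ((\<eta> + a) * V + 2 * a * C') * ennreal T = ennreal (((\<eta> + a) * V + 2 * a * C') * T)"
        using T \<eta> a0 V0 C' by (intro ennreal_mult[symmetric]) auto
      ultimately show ?thesis using T by (simp only: emeasure_lborel_Icc_eq) simp
    qed
    also have "\<dots> \<le> ennreal e" using \<eta>V aS by (intro ennreal_leI) simp
    finally show "(\<integral>\<^sup>+p\<in>{0..T} \<times> ball 0 R. ennreal (norm (Y p - mollify (k m) Y p)) \<partial>lborel) \<le> ennreal e" .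
  qed
qed

text \<open>
  Along the subsequence for which all mollifications converge, the flows are Cauchy in \<open>L\<^sup>1\<close> of
  \<open>[0,T] \<times> B(R)\<close>, the mollification error being uniformly small. Hence a further subsequence
  converges almost everywhere.
\<close>

lemma subsequence_AE_convergent_ball:
  fixes Y :: "nat \<Rightarrow> real \<times> 'a \<Rightarrow> 'a" and C R :: real
  assumes flow: "\<And>n. osgood_flow T M \<rho> (Y n) (G n)"
    and G: "\<And>n. (\<integral>\<^sup>+x\<in>ball 0 (R + 1). G n x \<partial>lborel) \<le> ennreal C"
  shows "\<exists>s. strict_mono (s :: nat \<Rightarrow> nat) \<and> (AE p in lborel. p \<in> {0..T} \<times> ball 0 R \<longrightarrow> convergent (\<lambda>i. Y (s i) p))"
proof -
  let ?P = "{0..T} \<times> ball (0::'a) R"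
  have Y_m: "Y n \<in> borel_measurable lborel" for n
    using osgood_flow_measurable(1)[OF flow[of n]] by (simp add: borel_prod)
  have A_m: "mollify (k m) (Y n) \<in> borel_measurable lborel" for m n
    using mollify_measurable[OF T M \<rho> inverse_Suc_pos k osgood_flow_measurable(1)[OF flow[of n]]] by (simp add: borel_prod)
  have P_m [measurable]: "?P \<in> sets lborel" by (simp add: borel_Times)
  have P_fin: "emeasure lborel ?P < \<infinity>"
    by (intro emeasure_bounded_finite bounded_Times) auto
  obtain s0 where s0: "strict_mono (s0 :: nat \<Rightarrow> nat)"
    and conv: "\<forall>m t x. t \<in> {0..T} \<longrightarrow> convergent (\<lambda>n. mollify (k m) (Y (s0 n)) (t, x))"
    by (rule mollified_subsequence[of Y G, OF flow]) blast
  define Z where "Z = (\<lambda>n. Y (s0 n))"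
  have Z_m [measurable]: "Z n \<in> borel_measurable lborel" for n unfolding Z_def by (rule Y_m)
  define u where "u = (\<lambda>n p. indicator ?P p *\<^sub>R Z n p)"
  have Z_bound: "norm (Z n p) \<le> R + M * T" if "p \<in> ?P" for n p
  proof -
    obtain t x where p: "p = (t, x)" by (cases p)
    have "norm (Z n (t, x)) \<le> norm x + M * T"
      unfolding Z_def using that p by (intro osgood_flow_norm_le[OF flow M]) auto
    also have "\<dots> \<le> R + M * T" using that p by simp
    finally show ?thesis by (simp add: p)
  qed
  have u_int: "integrable lborel (u n)" for n
    unfolding u_def using Z_bound
    by (intro integrableI_bounded_set_indicator[where B = "R + M * T", OF P_m Z_m P_fin] AE_I2) simp
  have close: "\<exists>N. \<forall>i\<ge>N. \<forall>j\<ge>N. (\<integral>\<^sup>+p. ennreal (norm (u i p - u j p)) \<partial>lborel) \<le> ennreal e"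
    if e: "0 < e" for e
  proof -
    have e4: "0 < e / 4" using e by simp
    obtain m where m: "\<And>Y G. osgood_flow T M \<rho> Y G \<Longrightarrow> (\<integral>\<^sup>+x\<in>ball 0 (R + 1). G x \<partial>lborel) \<le> ennreal C \<Longrightarrow>
      (\<integral>\<^sup>+p\<in>?P. ennreal (norm (Y p - mollify (k m) Y p)) \<partial>lborel) \<le> ennreal (e / 4)"
      by (rule mollify_uniformly_close[OF e4, of R C]) blast
    define a where "a = (\<lambda>n p. indicator ?P p *\<^sub>R mollify (k m) (Z n) p)"
    have a_m [measurable]: "a n \<in> borel_measurable lborel" for n
      unfolding a_def Z_def using A_m by measurable
    have ua: "(\<integral>\<^sup>+p. ennreal (norm (u n p - a n p)) \<partial>lborel) \<le> ennreal (e / 4)" for n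
    proof -
      have "(\<integral>\<^sup>+p. ennreal (norm (u n p - a n p)) \<partial>lborel)
        = (\<integral>\<^sup>+p\<in>?P. ennreal (norm (Z n p - mollify (k m) (Z n) p)) \<partial>lborel)"
        by (intro nn_integral_cong) (auto simp: u_def a_def indicator_def)
      also have "\<dots> \<le> ennreal (e / 4)" unfolding Z_def by (rule m[OF flow G])
      finally show ?thesis .
    qed
    define v where "v = (\<lambda>p. lim (\<lambda>n. a n p))"
    have v_m [measurable]: "v \<in> borel_measurable lborel" unfolding v_def by measurable
    have a_lim: "(\<lambda>n. a n p) \<longlonglongrightarrow> v p" for p
    proof -
      have "convergent (\<lambda>n. a n p)"
      proof (cases "p \<in> ?P")
        case True
        then have "convergent (\<lambda>n. mollify (k m) (Z n) p)"
          unfolding Z_def using conv[rule_format, of "fst p" m "snd p"] by auto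
        then show ?thesis using True by (simp add: a_def)
      qed (simp add: a_def convergent_const)
      then show ?thesis unfolding v_def by (simp add: convergent_LIMSEQ_iff)
    qed
    have "(\<lambda>n. (\<integral>\<^sup>+p. ennreal (norm (v p - a n p)) \<partial>lborel)) \<longlonglongrightarrow> 0"
    proof (rule nn_integral_dominated_convergence_norm[where w = "\<lambda>p. (R + 1 + M * T) * indicator ?P p"])
      show "AE p in lborel. norm (a n p) \<le> (R + 1 + M * T) * indicator ?P p" for n
      proof (intro AE_I2)
        fix p
        show "norm (a n p) \<le> (R + 1 + M * T) * indicator ?P p"
        proof (cases "p \<in> ?P")
          case True
          obtain t x where p: "p = (t, x)" by (cases p)
          have "norm (mollify (k m) (Z n) (t, x)) \<le> norm x + 1 / real (Suc m) + M * T"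
            unfolding Z_def using True p
            by (intro mollify_norm_le[OF T M \<rho> inverse_Suc_pos k flow]) auto
          also have "\<dots> \<le> R + 1 + M * T" using True p by (intro add_mono) auto
          finally show ?thesis using True by (simp add: a_def p)
        qed (simp add: a_def)
      qed
      have "(\<integral>\<^sup>+p. ennreal ((R + 1 + M * T) * indicator ?P p) \<partial>lborel) = (\<integral>\<^sup>+p. ennreal (R + 1 + M * T) * indicator ?P p \<partial>lborel)"
        by (intro nn_integral_cong) (auto simp: indicator_def)
      also have "\<dots> = ennreal (R + 1 + M * T) * emeasure lborel ?P" by (rule nn_integral_cmult_indicator[OF P_m])
      also have "\<dots> < \<infinity>" using P_fin by (simp add: ennreal_mult_less_top)
      finally show "(\<integral>\<^sup>+p. ennreal ((R + 1 + M * T) * indicator ?P p) \<partial>lborel) < \<infinity>" .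
    qed (use a_lim in auto)
    then have "eventually (\<lambda>n. (\<integral>\<^sup>+p. ennreal (norm (v p - a n p)) \<partial>lborel) < ennreal (e / 4)) sequentially"
      using e by (intro order_tendstoD(2)) auto
    then obtain N where N: "\<And>n. N \<le> n \<Longrightarrow> (\<integral>\<^sup>+p. ennreal (norm (v p - a n p)) \<partial>lborel) < ennreal (e / 4)"
      unfolding eventually_sequentially by blast
    have "(\<integral>\<^sup>+p. ennreal (norm (u i p - u j p)) \<partial>lborel) \<le> ennreal e" if ij: "N \<le> i" "N \<le> j" for i j
    proof -
      have tri: "ennreal (norm (u i p - u j p)) \<le> ennreal (norm (u i p - a i p)) + ennreal (norm (v p - a i p))
        + ennreal (norm (v p - a j p)) + ennreal (norm (u j p - a j p))" for p
      proof -
        have "u i p - u j p = (u i p - a i p) - (v p - a i p) + (v p - a j p) - (u j p - a j p)" by simp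
        also have "norm \<dots> \<le> norm (u i p - a i p) + norm (v p - a i p) + norm (v p - a j p) + norm (u j p - a j p)"
          using norm_triangle_ineq4[of "(u i p - a i p) - (v p - a i p) + (v p - a j p)" "u j p - a j p"]
            norm_triangle_ineq[of "(u i p - a i p) - (v p - a i p)" "v p - a j p"]
            norm_triangle_ineq4[of "u i p - a i p" "v p - a i p"] by linarith
        finally show ?thesis by (simp flip: ennreal_plus)
      qed
      have "(\<integral>\<^sup>+p. ennreal (norm (u i p - u j p)) \<partial>lborel) \<le> (\<integral>\<^sup>+p. ennreal (norm (u i p - a i p)) + ennreal (norm (v p - a i p))
        + ennreal (norm (v p - a j p)) + ennreal (norm (u j p - a j p)) \<partial>lborel)"
        by (intro nn_integral_mono tri)
      also have "\<dots> = (\<integral>\<^sup>+p. ennreal (norm (u i p - a i p)) \<partial>lborel) + (\<integral>\<^sup>+p. ennreal (norm (v p - a i p)) \<partial>lborel)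
        + (\<integral>\<^sup>+p. ennreal (norm (v p - a j p)) \<partial>lborel) + (\<integral>\<^sup>+p. ennreal (norm (u j p - a j p)) \<partial>lborel)"
        using borel_measurable_integrable[OF u_int] by (simp add: nn_integral_add)
      also have "\<dots> \<le> ennreal (e / 4) + ennreal (e / 4) + ennreal (e / 4) + ennreal (e / 4)"
        using N[OF ij(1)] N[OF ij(2)] by (intro add_mono ua) auto
      also have "\<dots> = ennreal e" using e by (simp flip: ennreal_plus)
      finally show ?thesis .
    qed
    then show ?thesis by blast
  qed
  have "\<exists>N. \<forall>i\<ge>N. \<forall>j\<ge>N. (LINT p|lborel. norm (u i p - u j p)) < e" if e: "0 < e" for e
  proof -
    obtain N where N: "\<And>i j. N \<le> i \<Longrightarrow> N \<le> j \<Longrightarrow> (\<integral>\<^sup>+p. ennreal (norm (u i p - u j p)) \<partial>lborel) \<le> ennreal (e / 2)"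
      using close[of "e / 2"] e by auto
    have "(LINT p|lborel. norm (u i p - u j p)) < e" if "N \<le> i" "N \<le> j" for i j
    proof -
      have "(LINT p|lborel. norm (u i p - u j p)) = enn2real (\<integral>\<^sup>+p. ennreal (norm (u i p - u j p)) \<partial>lborel)"
        using borel_measurable_integrable[OF u_int] by (intro integral_eq_nn_integral) auto
      also have "\<dots> \<le> e / 2" using N[OF that] e by (intro enn2real_leI) auto
      finally show ?thesis using e by simp
    qed
    then show ?thesis by blast
  qed
  then obtain r where r: "strict_mono r" "AE p in lborel. Cauchy (\<lambda>i. u (r i) p)"
    by (rule cauchy_L1_AE_cauchy_subseq[OF u_int])
  have "AE p in lborel. p \<in> ?P \<longrightarrow> convergent (\<lambda>i. Y ((s0 \<circ> r) i) p)"
    using r(2)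
  proof eventually_elim
    case (elim p)
    then show ?case by (auto simp: u_def Z_def Cauchy_convergent_iff)
  qed
  then show ?thesis using strict_mono_o[OF s0 r(1)] by blast
qed

text \<open>A diagonal argument over an exhausting sequence of balls.\<close>

lemma subsequence_AE_convergent:
  fixes Y :: "nat \<Rightarrow> real \<times> 'a \<Rightarrow> 'a"
  assumes flow: "\<And>n. osgood_flow T M \<rho> (Y n) (G n)"
    and G: "\<And>R. \<exists>C. \<forall>n. (\<integral>\<^sup>+x\<in>ball 0 R. G n x \<partial>lborel) \<le> ennreal C"
  obtains s where "strict_mono (s :: nat \<Rightarrow> nat)" "AE p in lborel. fst p \<in> {0..T} \<longrightarrow> convergent (\<lambda>i. Y (s i) p)"
proof -
  define P where "P = (\<lambda>(n::nat) s. AE p in lborel. p \<in> {0..T} \<times> ball 0 (real n) \<longrightarrow> convergent (\<lambda>i. Y (s i) p))"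
  have P_iff: "P n s \<longleftrightarrow> (AE p in lborel. p \<in> {0..T} \<times> ball 0 (real n) \<longrightarrow> convergent (\<lambda>i. Y (s i) p))" for n s
    by (simp add: P_def)
  interpret subseqs P
  proof
    fix n and s :: "nat \<Rightarrow> nat"
    obtain C where C: "\<And>i. (\<integral>\<^sup>+x\<in>ball 0 (real n + 1). G i x \<partial>lborel) \<le> ennreal C" using G by blast
    show "\<exists>r'. strict_mono r' \<and> P n (s \<circ> r')"
      using subsequence_AE_convergent_ball[of "\<lambda>i. Y (s i)" "\<lambda>i. G (s i)" "real n" C, OF flow C] by (simp add: P_def)
  qed
  have P: "P n (diagseq \<circ> (+) (Suc n))" for n
  proof (rule diagseq_holds)
    fix r s :: "nat \<Rightarrow> nat" and n
    assume r: "strict_mono r" and "P n s"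
    from this(2) show "P n (s \<circ> r)"
      unfolding P_def
    proof eventually_elim
      case (elim p)
      then show ?case using convergent_subseq_convergent[OF _ r, of "\<lambda>i. Y (s i) p"] by (auto simp: o_def)
    qed
  qed
  have "AE p in lborel. \<forall>n. p \<in> {0..T} \<times> ball 0 (real n) \<longrightarrow> convergent (\<lambda>i. Y (diagseq i) p)"
    unfolding AE_all_countable
  proof
    fix n
    show "AE p in lborel. p \<in> {0..T} \<times> ball 0 (real n) \<longrightarrow> convergent (\<lambda>i. Y (diagseq i) p)"
      using iffD1[OF P_iff P[of n]]
    proof eventually_elim
      case (elim p)
      then show ?case
        using convergent_ignore_initial_segment[of "\<lambda>i. Y (diagseq i) p" "Suc n"] by (simp add: o_def add.commute)
    qed
  qed
  then have "AE p in lborel. fst p \<in> {0..T} \<longrightarrow> convergent (\<lambda>i. Y (diagseq i) p)"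
  proof eventually_elim
    case (elim p)
    obtain n where "norm (snd p) < real n" using reals_Archimedean2 by blast
    then show ?case using elim[rule_format, of n] by (cases p) auto
  qed
  then show thesis by (rule that[OF subseq_diagseq])
qed

end

section \<open>Precompactness of flows\<close>

lemma AE_space_timeI:
  fixes X :: "real \<Rightarrow> 'a::euclidean_space \<Rightarrow> 'b"
  assumes "AE x in lborel. \<forall>t\<in>{0..T}. X t x = Y (t, x)"
  shows "AE p in lborel. fst p \<in> {0..T} \<longrightarrow> X (fst p) (snd p) = Y p"
proof -
  obtain S where S: "S \<in> sets lborel" "AE x in lborel. x \<in> S"
    and eq: "\<And>x. x \<in> S \<Longrightarrow> \<forall>t\<in>{0..T}. X t x = Y (t, x)"
    using assms by (rule AE_conull_borel_set) blast
  have [measurable]: "S \<in> sets borel" using S(1) by simp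
  have "AE p in lborel \<Otimes>\<^sub>M lborel. snd (p :: real \<times> 'a) \<in> S"
    by (rule lborel_pair.AE_pair_measure[OF pred_lborel_pair_sets]) (use S(2) in auto)
  then have "AE p in lborel. snd (p :: real \<times> 'a) \<in> S" unfolding lborel_prod .
  then show ?thesis by eventually_elim (use eq in auto)
qed

lemma L1_locI_AE:
  fixes f :: "real \<Rightarrow> 'a::euclidean_space \<Rightarrow> 'a" and h :: "real \<times> 'a \<Rightarrow> 'a"
  assumes h: "h \<in> borel_measurable lborel"
    and eq: "AE p in lborel. fst p \<in> {0..T} \<longrightarrow> f (fst p) (snd p) = h p"
    and bound: "AE p in lborel. fst p \<in> {0..T} \<longrightarrow> norm (h p) \<le> norm (snd p) + c"
  shows "f \<in> L1_loc T"
  unfolding L1_loc_def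
proof (intro CollectI allI impI)
  fix R :: real assume "0 < R"
  let ?P = "{0..T} \<times> ball (0::'a) R"
  have P: "?P \<in> sets lborel" by (simp add: borel_Times)
  have P_fin: "emeasure lborel ?P < \<infinity>" by (intro emeasure_bounded_finite bounded_Times) auto
  have int: "integrable lborel (\<lambda>p. indicator ?P p *\<^sub>R h p)"
  proof (rule integrableI_bounded_set_indicator[OF P h P_fin])
    show "AE p in lborel. p \<in> ?P \<longrightarrow> norm (h p) \<le> R + c"
      using bound by eventually_elim auto
  qed
  then have int': "integrable lebesgue (\<lambda>p. indicator ?P p *\<^sub>R h p)"
    by (subst integrable_completion) (auto dest: borel_measurable_integrable)
  have AE_eq: "AE p in lebesgue. indicator ?P p *\<^sub>R h p = indicator ?P p *\<^sub>R (case p of (t, x) \<Rightarrow> f t x)"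
    unfolding AE_completion_iff using eq by eventually_elim (auto simp: indicator_def)
  have meas: "(\<lambda>p. indicator ?P p *\<^sub>R (case p of (t, x) \<Rightarrow> f t x)) \<in> borel_measurable lebesgue"
    by (rule borel_measurable_AE[OF borel_measurable_integrable[OF int'] AE_eq])
  show "set_integrable lebesgue ?P (\<lambda>(t, x). f t x)"
    unfolding set_integrable_def by (rule Bochner_Integration.integrable_cong_AE_imp[OF int' meas]) (use AE_eq in auto)
qed

theorem theorem4p4:
  fixes T L :: real and \<rho> :: "real \<Rightarrow> real"
    and b X :: "nat \<Rightarrow> real \<Rightarrow> 'a::euclidean_space \<Rightarrow> 'a"
    and g :: "nat \<Rightarrow> real \<Rightarrow> 'a \<Rightarrow> real"
    and Lc :: "nat \<Rightarrow> real"
  assumes "T > 0"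
    and "osgood_modulus \<rho>"
    and "\<And>n. n \<ge> 1 \<Longrightarrow> (\<lambda>(t, x). b n t x) \<in> borel_measurable (space_time_measure T)"
    and "(SUP n\<in>{1..}. Linf_norm T (b n)) < \<infinity>"
    and "\<And>n. n \<ge> 1 \<Longrightarrow> condition_H T \<rho> (b n) (g n)"
    and "\<And>R. R > 0 \<Longrightarrow> (SUP n\<in>{1..}. L1_norm T R (g n)) < \<infinity>"
    and "\<And>n. n \<ge> 1 \<Longrightarrow> regular_lagrangian_flow T (b n) (X n)"
    and "\<And>n. n \<ge> 1 \<Longrightarrow> compressibility_constant T (X n) (Lc n)"
    and "\<And>n. n \<ge> 1 \<Longrightarrow> Lc n \<le> L"
  shows "precompact_L1_loc T {X n |n. n \<ge> 1}"
proof -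
  note T = assms(1) and \<rho> = assms(2)
  define M where "M = enn2real (SUP n\<in>{1..}. Linf_norm T (b n))"
  have M: "0 \<le> M" by (simp add: M_def)
  have bM: "Linf_norm T (b n) \<le> ennreal M" if "n \<ge> 1" for n
  proof -
    have "Linf_norm T (b n) \<le> (SUP n\<in>{1..}. Linf_norm T (b n))" by (rule SUP_upper) (use that in simp)
    also have "\<dots> = ennreal M" unfolding M_def using assms(4) by (intro ennreal_enn2real[symmetric]) simp
    finally show ?thesis .
  qed
  define \<Phi> where "\<Phi> = (\<lambda>n Y G. osgood_flow T M \<rho> Y G \<and> (AE x in lborel. \<forall>t\<in>{0..T}. X n t x = Y (t, x)) \<and>
      (\<forall>R. (\<integral>\<^sup>+x\<in>ball 0 R. G x \<partial>lborel) \<le> ennreal (Lc n) * L1_norm T (R + M * T) (g n)))"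
  have "\<exists>p. n \<ge> 1 \<longrightarrow> \<Phi> n (fst p) (snd p)" for n
  proof (cases "n \<ge> 1")
    case n: True
    show ?thesis
    proof (rule flow_osgood_estimate[OF T \<rho> M bM[OF n] assms(5)[OF n] assms(7)[OF n] assms(8)[OF n]])
      fix Y G
      assume "osgood_flow T M \<rho> Y G" "AE x in lborel. \<forall>t\<in>{0..T}. X n t x = Y (t, x)"
        and *: "\<And>R. (\<integral>\<^sup>+x\<in>ball 0 R. G x \<partial>lborel) \<le> ennreal (Lc n) * L1_norm T (R + M * T) (g n)"
      then have "\<Phi> n Y G" unfolding \<Phi>_def by (intro conjI allI *)
      then show ?thesis by (intro exI[of _ "(Y, G)"]) simp
    qed
  qed simp
  then have "\<forall>n. \<exists>p. n \<ge> 1 \<longrightarrow> \<Phi> n (fst p) (snd p)" by blast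
  from choice[OF this] obtain p where p: "\<And>n. n \<ge> 1 \<Longrightarrow> \<Phi> n (fst (p n)) (snd (p n))" by blast
  define Y where "Y = (\<lambda>n. fst (p n))"
  define G where "G = (\<lambda>n. snd (p n))"
  have flow: "osgood_flow T M \<rho> (Y n) (G n)"
    and XY: "AE x in lborel. \<forall>t\<in>{0..T}. X n t x = Y n (t, x)"
    and G: "(\<integral>\<^sup>+x\<in>ball 0 R. G n x \<partial>lborel) \<le> ennreal (Lc n) * L1_norm T (R + M * T) (g n)"
    if "n \<ge> 1" for n R
    using p[OF that] unfolding \<Phi>_def Y_def G_def by blast+
  have Y_m: "Y n \<in> borel_measurable lborel" if "n \<ge> 1" for n
    using osgood_flow_measurable(1)[OF flow[OF that]] by (simp add: borel_prod)
  have XY': "AE p in lborel. fst p \<in> {0..T} \<longrightarrow> X n (fst p) (snd p) = Y n p" if "n \<ge> 1" for n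
    by (rule AE_space_timeI[OF XY[OF that]])
  have Y_bound: "norm (Y n p) \<le> norm (snd p) + M * T" if "n \<ge> 1" "fst p \<in> {0..T}" for n p
    using osgood_flow_norm_le[OF flow[OF that(1)] M that(2), of "snd p"] by simp
  have G_bound: "\<exists>C. \<forall>n\<ge>1. (\<integral>\<^sup>+x\<in>ball 0 R. G n x \<partial>lborel) \<le> ennreal C" for R
  proof (intro exI allI impI)
    let ?R = "\<bar>R\<bar> + 1 + M * T"
    let ?S = "SUP n\<in>{1..}. L1_norm T ?R (g n)"
    fix n :: nat assume n: "n \<ge> 1"
    have "0 \<le> M * T" using M T by simp
    then have S: "?S < \<infinity>" by (intro assms(6)) linarith
    have "(\<integral>\<^sup>+x\<in>ball 0 R. G n x \<partial>lborel) \<le> (\<integral>\<^sup>+x\<in>ball 0 (\<bar>R\<bar> + 1). G n x \<partial>lborel)"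
      by (intro nn_integral_mono) (auto simp: indicator_def)
    also have "\<dots> \<le> ennreal (Lc n) * L1_norm T ?R (g n)" by (rule G[OF n])
    also have "\<dots> \<le> ennreal L * ?S"
      using n by (intro mult_mono ennreal_leI assms(9) SUP_upper) auto
    also have "\<dots> = ennreal (enn2real (ennreal L * ?S))"
      using S by (intro ennreal_enn2real[symmetric]) (simp add: ennreal_mult_less_top)
    finally show "(\<integral>\<^sup>+x\<in>ball 0 R. G n x \<partial>lborel) \<le> ennreal (enn2real (ennreal L * ?S))" .
  qed
  have "\<forall>m. \<exists>K. \<exists>k :: 'a \<Rightarrow> real. mollifier (1 / real (Suc m)) K k"
    by (intro allI mollifier_exists) simp
  from choice[OF this] obtain K where "\<forall>m. \<exists>k :: 'a \<Rightarrow> real. mollifier (1 / real (Suc m)) (K m) k" by blast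
  from choice[OF this] obtain k :: "nat \<Rightarrow> 'a \<Rightarrow> real"
    where k: "\<And>m. mollifier (1 / real (Suc m)) (K m) (k m)" by blast
  show ?thesis
    unfolding precompact_L1_loc_def
  proof (intro conjI allI impI)
    show "{X n |n. n \<ge> 1} \<subseteq> L1_loc T"
    proof safe
      fix n :: nat assume n: "n \<ge> 1"
      show "X n \<in> L1_loc T"
        by (rule L1_locI_AE[OF Y_m[OF n] XY'[OF n], where c = "M * T"]) (use Y_bound[OF n] in auto)
    qed
  next
    fix u :: "nat \<Rightarrow> real \<Rightarrow> 'a \<Rightarrow> 'a"
    assume "range u \<subseteq> {X n |n. n \<ge> 1}"
    then have "\<forall>i. \<exists>n. n \<ge> 1 \<and> u i = X n" by blast
    from choice[OF this] obtain \<sigma> where \<sigma>: "\<And>i. \<sigma> i \<ge> 1" and u: "\<And>i. u i = X (\<sigma> i)" by blast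
    have G_bound': "\<exists>C. \<forall>i. (\<integral>\<^sup>+x\<in>ball 0 R. G (\<sigma> i) x \<partial>lborel) \<le> ennreal C" for R
      using G_bound[of R] \<sigma> by blast
    have "\<exists>s. strict_mono (s :: nat \<Rightarrow> nat) \<and> (AE p in lborel. fst p \<in> {0..T} \<longrightarrow> convergent (\<lambda>i. Y (\<sigma> (s i)) p))"
      by (rule subsequence_AE_convergent[of T M \<rho> K k "\<lambda>i. Y (\<sigma> i)" "\<lambda>i. G (\<sigma> i)", OF T M \<rho> k flow[OF \<sigma>] G_bound'])
        blast
    then obtain s where s: "strict_mono (s :: nat \<Rightarrow> nat)"
      and conv: "AE p in lborel. fst p \<in> {0..T} \<longrightarrow> convergent (\<lambda>i. Y (\<sigma> (s i)) p)" by blast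
    define Z where "Z = (\<lambda>i. Y (\<sigma> (s i)))"
    have Z_m [measurable]: "Z i \<in> borel_measurable lborel" for i unfolding Z_def by (rule Y_m[OF \<sigma>])
    have uZ: "AE p in lborel. fst p \<in> {0..T} \<longrightarrow> u (s i) (fst p) (snd p) = Z i p" for i
      using XY'[OF \<sigma>, of "s i"] by (simp add: u Z_def)
    have Z_bound: "norm (Z i p) \<le> norm (snd p) + M * T" if "fst p \<in> {0..T}" for i p
      unfolding Z_def by (rule Y_bound[OF \<sigma> that])
    define v where "v = (\<lambda>p. lim (\<lambda>i. Z i p))"
    have v_m [measurable]: "v \<in> borel_measurable lborel" unfolding v_def by measurable
    have Z_lim: "AE p in lborel. fst p \<in> {0..T} \<longrightarrow> (\<lambda>i. Z i p) \<longlonglongrightarrow> v p"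
      using conv by eventually_elim (simp add: Z_def v_def convergent_LIMSEQ_iff)
    have v_bound: "AE p in lborel. fst p \<in> {0..T} \<longrightarrow> norm (v p) \<le> norm (snd p) + M * T"
      using Z_lim
    proof eventually_elim
      case (elim p)
      show ?case
      proof
        assume p: "fst p \<in> {0..T}"
        with elim have "(\<lambda>i. norm (Z i p)) \<longlonglongrightarrow> norm (v p)" by (intro tendsto_norm) auto
        then show "norm (v p) \<le> norm (snd p) + M * T"
          by (rule LIMSEQ_le_const2) (use Z_bound[OF p] in auto)
      qed
    qed
    have "(\<lambda>i. L1_norm T R (\<lambda>t x. u (s i) t x - v (t, x))) \<longlonglongrightarrow> 0" if R: "0 < R" for R
    proof -
      let ?P = "{0..T} \<times> ball (0::'a) R"
      have P_m [measurable]: "?P \<in> sets lborel" by (simp add: borel_Times)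
      have P_fin: "emeasure lborel ?P < \<infinity>" by (intro emeasure_bounded_finite bounded_Times) auto
      have norm_eq: "L1_norm T R (\<lambda>t x. u (s i) t x - v (t, x))
        = (\<integral>\<^sup>+p. ennreal (norm (indicator ?P p *\<^sub>R v p - indicator ?P p *\<^sub>R Z i p)) \<partial>lborel)" for i
        unfolding L1_norm_def nn_integral_completion
        using uZ[of i] by (intro nn_integral_cong_AE, eventually_elim) (auto simp: indicator_def norm_minus_commute)
      have "(\<lambda>i. \<integral>\<^sup>+p. ennreal (norm (indicator ?P p *\<^sub>R v p - indicator ?P p *\<^sub>R Z i p)) \<partial>lborel) \<longlonglongrightarrow> 0"
      proof (rule nn_integral_dominated_convergence_norm[where w = "\<lambda>p. (R + M * T) * indicator ?P p"])
        show "AE p in lborel. norm (indicator ?P p *\<^sub>R Z i p) \<le> (R + M * T) * indicator ?P p" for i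
        proof (intro AE_I2)
          fix p
          show "norm (indicator ?P p *\<^sub>R Z i p) \<le> (R + M * T) * indicator ?P p"
            using Z_bound[of p i] by (cases "p \<in> ?P") auto
        qed
        have "(\<integral>\<^sup>+p. ennreal ((R + M * T) * indicator ?P p) \<partial>lborel) = (\<integral>\<^sup>+p. ennreal (R + M * T) * indicator ?P p \<partial>lborel)"
          by (intro nn_integral_cong) (auto simp: indicator_def)
        also have "\<dots> = ennreal (R + M * T) * emeasure lborel ?P" by (rule nn_integral_cmult_indicator[OF P_m])
        also have "\<dots> < \<infinity>" using P_fin by (simp add: ennreal_mult_less_top)
        finally show "(\<integral>\<^sup>+p. ennreal ((R + M * T) * indicator ?P p) \<partial>lborel) < \<infinity>" .
        show "AE p in lborel. (\<lambda>i. indicator ?P p *\<^sub>R Z i p) \<longlonglongrightarrow> indicator ?P p *\<^sub>R v p"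
          using Z_lim by eventually_elim (auto simp: indicator_def)
      qed measurable
      then show ?thesis by (simp only: norm_eq)
    qed
    moreover have "(\<lambda>t x. v (t, x)) \<in> L1_loc T"
      by (rule L1_locI_AE[OF v_m _ v_bound]) simp
    ultimately show "\<exists>r v. strict_mono r \<and> v \<in> L1_loc T \<and>
        (\<forall>R>0. (\<lambda>i. L1_norm T R (\<lambda>t x. u (r i) t x - v t x)) \<longlonglongrightarrow> 0)"
      using s by (intro exI[of _ s] exI[of _ "\<lambda>t x. v (t, x)"]) auto
  qed
qed

end
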